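(* Let $z:V\to\mathbb{C}$ be a realization of a simply connected triangular mesh. Then every discrete holomorphic quadratic differential $q:E_{int}\to i\mathbb{R}$ on $z$ is of the form $$q_{ij}=du_z(e^*_{ij})\,dz(e_{ij})\qquad\text{for all oriented interior edges } e_{ij}$$ for some harmonic function $u:V\to\mathbb{R}$ (with respect to the cotangent Laplacian). Furthermore, the space of discrete holomorphic quadratic differentials on $z$ is a (real) vector space isomorphic to the space of harmonic functions $V\to\mathbb{R}$ modulo linear functions, where a linear function is a function of the form $u_i=\operatorname{Re}(\bar a z_i)+b$ with $a\in\mathbb{C}$, $b\in\mathbb{R}$.
   Context: A triangular mesh is an oriented simplicial complex whose underlying topological space is a connected 2-manifold (possibly with boundary); $V,E,F$ are its sets of vertices, edges and triangles, $V_{int}$, $E_{int}$ its sets of interior vertices and interior edges. A realization is a map $z:V\to\mathbb{C}$ such that for each triangle $\{ijk\}\in F$ the points $z_i,z_j,z_k$ are not collinear. For an oriented edge $e_{ij}$ from $i$ to $j$ write $dz(e_{ij})=z_j-z_i$; if it is interior, $\{ijk\}$ denotes its left face and $\{jil\}$ its right face, and $e_{ij}^*$ is the dual edge oriented from the right face to the left face. Write $\langle a,b\rangle=\operatorname{Re}(\bar a b)$. For $u:V\to\mathbb{R}$, the gradient $\operatorname{grad}_z u:F\to\mathbb{C}$ (of the piecewise-linear interpolation) is $\operatorname{grad}_z u_{ijk}= i\,\frac{u_i dz(e_{jk})+u_j dz(e_{ki})+u_k dz(e_{ij})}{2A_{ijk}}$, where $A_{ijk}$ is the signed area of the realized triangle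 (positive iff $z$ preserves the orientation of that triangle); equivalently it is the unique vector with $\langle\operatorname{grad}_z u_{ijk},z_b-z_a\rangle=u_b-u_a$ for all vertices $a,b$ of the triangle. Put $u_z:=\frac12\overline{\operatorname{grad}_z u}:F\to\mathbb{C}$ and $du_z(e^*_{ij}):=(u_z)_{ijk}-(u_z)_{jil}$. A function $q:E_{int}\to i\mathbb{R}$ is a discrete holomorphic quadratic differential on $z$ if for every interior vertex $i$: $\sum_j q_{ij}=0$ and $\sum_j q_{ij}/(z_j-z_i)=0$ (sums over all neighbours $j$ of $i$). A function $u:V\to\mathbb{R}$ is harmonic (cotangent Laplacian) if for every interior vertex $i$: $\sum_j(\cot\beta_{ij}^k+\cot\beta_{ji}^l)(u_j-u_i)=0$, where $\beta_{ij}^k$ is the angle at $k$ in the triangle $z_i,z_j,z_k$ and $\beta_{ji}^l$ the angle at $l$ in the triangle $z_j,z_i,z_l$; angles lie in $(0,\pi)$ up to sign, with positive sign if $z$ preserves the orientation of the triangle and negative sign otherwise. *)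

theory Defs
  imports "HOL-Analysis.Analysis" "HOL-Library.Function_Algebras"
begin

section \<open>Surfaces\<close>

definition two_manifold_with_boundary :: "'a::topological_space set \<Rightarrow> bool" where
  "two_manifold_with_boundary S \<longleftrightarrow>
     Hausdorff_space (top_of_set S) \<and> second_countable (top_of_set S) \<and>
     (\<forall>x\<in>S. \<exists>U W. openin (top_of_set S) U \<and> x \<in> U \<and>
        openin (top_of_set {w::complex. 0 \<le> Im w}) W \<and> U homeomorphic W)"

definition manifold_interior :: "'a::topological_space set \<Rightarrow> 'a set" where
  "manifold_interior S =
     {x \<in> S. \<exists>U (W::complex set). openin (top_of_set S) U \<and> x \<in> U \<and> open W \<and> U homeomorphic W}"

definition manifold_boundary :: "'a::topological_space set \<Rightarrow> 'a set" where
  "manifold_boundary S = S - manifold_interior S"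

section \<open>Triangular meshes\<close>

definition abstract_simplicial_complex :: "'v set set \<Rightarrow> bool" where
  "abstract_simplicial_complex K \<longleftrightarrow>
     (\<forall>s\<in>K. finite s \<and> s \<noteq> {}) \<and> (\<forall>s\<in>K. \<forall>t. t \<subseteq> s \<and> t \<noteq> {} \<longrightarrow> t \<in> K)"

text \<open>Points of the underlying space are given by their barycentric coordinates, and the topology
  is that of coordinatewise convergence (the subspace topology of the product topology on
  \<^typ>\<open>'v \<Rightarrow> real\<close>). For locally finite complexes this is the usual topology of the geometric
  realization; a complex that is a manifold, in this topology or in the weak one, is locally
  finite.\<close>

definition underlying_space :: "'v set set \<Rightarrow> ('v \<Rightarrow> real) set" where
  "underlying_space K =
     {x. (\<forall>v. 0 \<le> x v) \<and> {v. x v \<noteq> 0} \<in> K \<and> (\<Sum>v | x v \<noteq> 0. x v) = 1}"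

definition closed_simplex :: "'v set set \<Rightarrow> 'v set \<Rightarrow> ('v \<Rightarrow> real) set" where
  "closed_simplex K s = {x \<in> underlying_space K. {v. x v \<noteq> 0} \<subseteq> s}"

text \<open>A coherent orientation of the triangles: \<^term>\<open>T\<close> consists of all triples that list the
  vertices of a triangle in positive cyclic order. The last condition says that two triangles
  sharing an edge induce opposite orientations on it.\<close>

definition mesh_orientation :: "'v set set \<Rightarrow> ('v \<times> 'v \<times> 'v) set \<Rightarrow> bool" where
  "mesh_orientation K T \<longleftrightarrow>
     (\<forall>i j k. (i, j, k) \<in> T \<longrightarrow> {i, j, k} \<in> K \<and> distinct [i, j, k]) \<and>
     (\<forall>i j k. (i, j, k) \<in> T \<longrightarrow> (j, k, i) \<in> T) \<and>
     (\<forall>i j k. {i, j, k} \<in> K \<and> distinct [i, j, k] \<longrightarrow> ((i, j, k) \<in> T) \<noteq> ((j, i, k) \<in> T)) \<and>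
     (\<forall>i j k l. (i, j, k) \<in> T \<and> (i, j, l) \<in> T \<longrightarrow> k = l)"

definition triangular_mesh :: "'v set set \<Rightarrow> ('v \<times> 'v \<times> 'v) set \<Rightarrow> bool" where
  "triangular_mesh K T \<longleftrightarrow>
     abstract_simplicial_complex K \<and> (\<forall>s\<in>K. card s \<le> 3) \<and> mesh_orientation K T \<and>
     two_manifold_with_boundary (underlying_space K) \<and> connected (underlying_space K)"

definition vertices :: "'v set set \<Rightarrow> 'v set" where
  "vertices K = {i. {i} \<in> K}"

definition interior_vertices :: "'v set set \<Rightarrow> 'v set" where
  "interior_vertices K =
     {i \<in> vertices K. \<not> closed_simplex K {i} \<subseteq> manifold_boundary (underlying_space K)}"

text \<open>An interior edge is one that is not contained in the boundary of the surface; its end points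
  may lie on the boundary.\<close>

definition interior_edges :: "'v set set \<Rightarrow> 'v set set" where
  "interior_edges K =
     {e \<in> K. card e = 2 \<and> \<not> closed_simplex K e \<subseteq> manifold_boundary (underlying_space K)}"

definition neighbours :: "'v set set \<Rightarrow> 'v \<Rightarrow> 'v set" where
  "neighbours K i = {j. j \<noteq> i \<and> {i, j} \<in> K}"

text \<open>The left face of the oriented edge from \<^term>\<open>i\<close> to \<^term>\<open>j\<close> is
  \<open>(i, j, left_vertex T i j)\<close> and its right face is \<open>(j, i, left_vertex T j i)\<close>. Both exist
  if the edge is interior.\<close>

definition left_vertex :: "('v \<times> 'v \<times> 'v) set \<Rightarrow> 'v \<Rightarrow> 'v \<Rightarrow> 'v" where
  "left_vertex T i j = (THE k. (i, j, k) \<in> T)"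

definition realization :: "('v \<times> 'v \<times> 'v) set \<Rightarrow> ('v \<Rightarrow> complex) \<Rightarrow> bool" where
  "realization T z \<longleftrightarrow> (\<forall>i j k. (i, j, k) \<in> T \<longrightarrow> \<not> collinear {z i, z j, z k})"

section \<open>Gradients and harmonic functions\<close>

text \<open>In the following three definitions the triple of vertices is meant to be positively oriented
  in the mesh.\<close>

definition signed_area :: "('v \<Rightarrow> complex) \<Rightarrow> 'v \<Rightarrow> 'v \<Rightarrow> 'v \<Rightarrow> real" where
  "signed_area z i j k = Im (cnj (z j - z i) * (z k - z i)) / 2"

definition grad :: "('v \<Rightarrow> complex) \<Rightarrow> ('v \<Rightarrow> real) \<Rightarrow> 'v \<Rightarrow> 'v \<Rightarrow> 'v \<Rightarrow> complex" where
  "grad z u i j k =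
     \<i> * (of_real (u i) * (z k - z j) + of_real (u j) * (z i - z k) + of_real (u k) * (z j - z i))
       / of_real (2 * signed_area z i j k)"

text \<open>The angle at \<^term>\<open>k\<close>, with positive sign iff \<^term>\<open>z\<close> preserves the orientation of the
  triangle.\<close>

definition signed_angle :: "('v \<Rightarrow> complex) \<Rightarrow> 'v \<Rightarrow> 'v \<Rightarrow> 'v \<Rightarrow> real" where
  "signed_angle z i j k =
     sgn (signed_area z i j k) *
     arccos (((z i - z k) \<bullet> (z j - z k)) / (norm (z i - z k) * norm (z j - z k)))"

definition u_z :: "('v \<Rightarrow> complex) \<Rightarrow> ('v \<Rightarrow> real) \<Rightarrow> 'v \<Rightarrow> 'v \<Rightarrow> 'v \<Rightarrow> complex" where
  "u_z z u i j k = cnj (grad z u i j k) / 2"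

definition du_z ::
    "('v \<times> 'v \<times> 'v) set \<Rightarrow> ('v \<Rightarrow> complex) \<Rightarrow> ('v \<Rightarrow> real) \<Rightarrow> 'v \<Rightarrow> 'v \<Rightarrow> complex" where
  "du_z T z u i j = u_z z u i j (left_vertex T i j) - u_z z u j i (left_vertex T j i)"

text \<open>A real function on the vertices is represented by its extension by \<open>0\<close> to \<^typ>\<open>'v\<close>, and
  similarly for functions on the interior edges; in this way distinct functions have distinct
  representatives.\<close>

definition harmonic_functions ::
    "'v set set \<Rightarrow> ('v \<times> 'v \<times> 'v) set \<Rightarrow> ('v \<Rightarrow> complex) \<Rightarrow> ('v \<Rightarrow> real) set" where
  "harmonic_functions K T z =
     {u. (\<forall>i. i \<notin> vertices K \<longrightarrow> u i = 0) \<and>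
         (\<forall>i \<in> interior_vertices K.
            (\<Sum>j \<in> neighbours K i.
               (cot (signed_angle z i j (left_vertex T i j)) +
                cot (signed_angle z j i (left_vertex T j i))) * (u j - u i)) = 0)}"

definition linear_functions :: "'v set set \<Rightarrow> ('v \<Rightarrow> complex) \<Rightarrow> ('v \<Rightarrow> real) set" where
  "linear_functions K z =
     {u. \<exists>(a::complex) (b::real).
           u = (\<lambda>i. if i \<in> vertices K then Re (cnj a * z i) + b else 0)}"

definition holomorphic_quadratic_differentials ::
    "'v set set \<Rightarrow> ('v \<Rightarrow> complex) \<Rightarrow> ('v set \<Rightarrow> complex) set" where
  "holomorphic_quadratic_differentials K z =
     {q. (\<forall>e. e \<notin> interior_edges K \<longrightarrow> q e = 0) \<and>
         (\<forall>e \<in> interior_edges K. Re (q e) = 0) \<and>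
         (\<forall>i \<in> interior_vertices K.
            (\<Sum>j \<in> neighbours K i. q {i, j}) = 0 \<and>
            (\<Sum>j \<in> neighbours K i. q {i, j} / (z j - z i)) = 0)}"

section \<open>Quotients of spaces of functions\<close>

definition fun_scale :: "real \<Rightarrow> ('a \<Rightarrow> 'b::real_vector) \<Rightarrow> 'a \<Rightarrow> 'b" where
  "fun_scale c f = (\<lambda>x. c *\<^sub>R f x)"

interpretation fun_space: vector_space "fun_scale :: real \<Rightarrow> ('a \<Rightarrow> 'b::real_vector) \<Rightarrow> 'a \<Rightarrow> 'b"
  by unfold_locales (auto simp: fun_scale_def fun_eq_iff algebra_simps)

definition coset_rel :: "('a \<Rightarrow> 'b::real_vector) set \<Rightarrow> ('a \<Rightarrow> 'b) set \<Rightarrow> ('a \<Rightarrow> 'b) rel" where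
  "coset_rel U L = {(u, v). u \<in> U \<and> v \<in> U \<and> u - v \<in> L}"

text \<open>\<open>W\<close> is linearly isomorphic to the quotient space \<open>U / L\<close>: the elements of the latter are the
  classes \<open>coset_rel U L `` {u}\<close>, with operations defined on representatives.\<close>

definition isomorphic_to_quotient ::
    "('c \<Rightarrow> 'd::real_vector) set \<Rightarrow> ('a \<Rightarrow> 'b::real_vector) set \<Rightarrow> ('a \<Rightarrow> 'b) set \<Rightarrow> bool" where
  "isomorphic_to_quotient W U L \<longleftrightarrow>
     fun_space.subspace W \<and> fun_space.subspace U \<and> fun_space.subspace L \<and> L \<subseteq> U \<and>
     (\<exists>\<Phi>. bij_betw \<Phi> (U // coset_rel U L) W \<and>
        (\<forall>u\<in>U. \<forall>v\<in>U. \<Phi> (coset_rel U L `` {u + v}) =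
           \<Phi> (coset_rel U L `` {u}) + \<Phi> (coset_rel U L `` {v})) \<and>
        (\<forall>c. \<forall>u\<in>U. \<Phi> (coset_rel U L `` {fun_scale c u}) = fun_scale c (\<Phi> (coset_rel U L `` {u}))))"

end

theory Submission
  imports Defs
begin

text \<open>For a holomorphic quadratic differential \<open>q\<close> let \<open>l\<^sub>i\<^sub>j\<close> be the affine function
  \<open>w \<mapsto> Re (2 q\<^sub>i\<^sub>j (w - z\<^sub>i) / (z\<^sub>j - z\<^sub>i))\<close>. As \<open>q\<close> is imaginary, \<open>l\<^sub>i\<^sub>j\<close> vanishes at
  \<open>z\<^sub>i\<close> and \<open>z\<^sub>j\<close> and \<open>l\<^sub>j\<^sub>i = - l\<^sub>i\<^sub>j\<close>; by \<open>\<Sum>\<^sub>j q\<^sub>i\<^sub>j / (z\<^sub>j - z\<^sub>i) = 0\<close> the sum of the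
  \<open>l\<^sub>i\<^sub>j\<close> around an interior vertex is zero. Since the mesh is simply connected, there are affine
  functions on the faces with jumps \<open>l\<^sub>i\<^sub>j\<close> across the edges. They agree at common vertices, hence
  form a piecewise linear function \<open>u\<close> with \<open>q = du\<^sub>z dz\<close>. For every \<open>u\<close> the sum of \<open>du\<^sub>z dz\<close>
  around a vertex is \<open>- \<i> / 2\<close> times the cotangent Laplacian of \<open>u\<close>, so the other condition
  on \<open>q\<close> says that \<open>u\<close> is harmonic, and \<open>du\<^sub>z = 0\<close> says that the gradient is constant.\<close>

section \<open>Cocycles on simply connected spaces\<close>

text \<open>Interior vertices, interior edges and simple connectivity are topological notions,
  whereas jumps and sums around a vertex are combinatorial. Invariance of domain bridges the first
  gap: interior edges are those with two faces, interior vertices those all of whose edges have two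
  faces. Simple connectivity enters through the open stars of vertices: a closed simplicial
  1-cochain yields increments between nearby points whose sums along paths are homotopy invariant.
  The jumps of the affine functions form a dual cochain; the primal one comes from the constants by
  which potentials around adjacent vertices differ. The mesh may be infinite, and even finiteness of
  the degrees has to be extracted from local compactness. Links are not classified as cycles or
  arcs: finite degree, a connected link and the successor map \<open>left_vertex T v\<close>
  suffice.\<close>

text \<open>\<open>\<phi> a b\<close> plays the role of an increment \<open>f b - f a\<close> of an
  unknown \<open>f\<close>, consistent inside \<open>U\<close> although a global \<open>f\<close>
  may fail to exist.\<close>

definition cocycle_on :: "'a set \<Rightarrow> ('a \<Rightarrow> 'a \<Rightarrow> 'b::ab_group_add) \<Rightarrow> bool" where
  "cocycle_on U \<phi> \<longleftrightarrow> (\<forall>a\<in>U. \<forall>b\<in>U. \<forall>c\<in>U. \<phi> a b + \<phi> b c = \<phi> a c)"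

lemma cocycle_on_refl: "cocycle_on U \<phi> \<Longrightarrow> a \<in> U \<Longrightarrow> \<phi> a a = 0"
  unfolding cocycle_on_def by (metis add_cancel_right_right)

lemma cocycle_on_telescope:
  assumes "cocycle_on U \<phi>" "\<And>k. k \<le> n \<Longrightarrow> x k \<in> U"
  shows "(\<Sum>k<n. \<phi> (x k) (x (Suc k))) = \<phi> (x 0) (x n)"
  using assms(2)
proof (induction n)
  case 0
  then show ?case using cocycle_on_refl[OF assms(1)] by simp
next
  case (Suc n)
  then have "\<phi> (x 0) (x n) + \<phi> (x n) (x (Suc n)) = \<phi> (x 0) (x (Suc n))"
    using assms(1) unfolding cocycle_on_def by auto
  then show ?case using Suc by simp
qed

section \<open>Sums of increments along paths\<close>

definition path_sum :: "('a \<Rightarrow> 'a \<Rightarrow> 'b::ab_group_add) \<Rightarrow> nat \<Rightarrow> (real \<Rightarrow> 'a) \<Rightarrow> 'b" where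
  "path_sum \<phi> n p = (\<Sum>k<n. \<phi> (p (real k / real n)) (p (real (Suc k) / real n)))"

text \<open>The number of parts ranges over the multiples of one \<open>n\<close>, since subdividing
  a fine enough partition keeps its sum. Two such values for one path agree, because the two numbers
  of parts have a common multiple.\<close>

definition has_path_sum :: "('a \<Rightarrow> 'a \<Rightarrow> 'b::ab_group_add) \<Rightarrow> (real \<Rightarrow> 'a) \<Rightarrow> 'b \<Rightarrow> bool" where
  "has_path_sum \<phi> p s \<longleftrightarrow> (\<exists>n>0. \<forall>m>0. path_sum \<phi> (n * m) p = s)"

lemma has_path_sum_within:
  assumes "cocycle_on U \<phi>" "p ` {0..1} \<subseteq> U"
  shows "has_path_sum \<phi> p (\<phi> (p 0) (p 1))"
proof -
  have "path_sum \<phi> m p = \<phi> (p 0) (p 1)" if "m > 0" for m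
  proof -
    have "path_sum \<phi> m p = \<phi> (p (real 0 / real m)) (p (real m / real m))"
      unfolding path_sum_def
      by (rule cocycle_on_telescope[OF assms(1)]) (use assms(2) that in \<open>auto simp: image_subset_iff\<close>)
    then show ?thesis using that by simp
  qed
  then show ?thesis unfolding has_path_sum_def by (intro exI[of _ 1]) simp
qed

text \<open>Each of the \<open>n\<close> pieces stays in a set where \<open>\<phi>\<close> is a
  cocycle, so the \<open>m\<close> increments that replace a coarse one telescope back to
  it.\<close>

lemma has_path_sum_refine:
  assumes "n > 0"
    and "\<And>k. k < n \<Longrightarrow> \<exists>U. cocycle_on U \<phi> \<and> p ` {real k / real n .. real (Suc k) / real n} \<subseteq> U"
  shows "has_path_sum \<phi> p (path_sum \<phi> n p)"
  unfolding has_path_sum_def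
proof (intro exI[of _ n] conjI allI impI assms(1))
  fix m :: nat
  assume m: "m > 0"
  define f where "f k = \<phi> (p (real k / real (n*m))) (p (real (Suc k) / real (n*m)))" for k
  have "path_sum \<phi> (n * m) p = (\<Sum>k<n. sum f {k*m..<k*m+m})"
    unfolding path_sum_def f_def by (simp only: sum.nat_group)
  also have "\<dots> = path_sum \<phi> n p"
    unfolding path_sum_def
  proof (rule sum.cong[OF refl])
    fix k
    assume "k \<in> {..<n}"
    then have "k < n" by simp
    then obtain U where U: "cocycle_on U \<phi>" "p ` {real k / real n .. real (Suc k) / real n} \<subseteq> U"
      using assms(2)[of k] by blast
    define x where "x j = p (real (k*m+j) / real (n*m))" for j
    have "sum f {k*m..<k*m+m} = (\<Sum>j<m. f (k*m + j))"
      using sum.shift_bounds_nat_ivl[of f 0 "k*m" m]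
      by (simp add: atLeast0LessThan add.commute)
    also have "\<dots> = (\<Sum>j<m. \<phi> (x j) (x (Suc j)))"
      by (simp add: f_def x_def)
    also have "\<dots> = \<phi> (x 0) (x m)"
    proof (rule cocycle_on_telescope[OF U(1)])
      fix j
      assume "j \<le> m"
      then have "real k / real n \<le> real (k*m+j) / real (n*m)"
        "real (k*m+j) / real (n*m) \<le> real (Suc k) / real n"
        using m assms(1) by (auto simp: field_simps mult_left_mono)
      then show "x j \<in> U" using U(2) unfolding x_def by auto
    qed
    also have "x 0 = p (real k / real n)" using m assms(1) by (simp add: x_def)
    also have "x m = p (real (Suc k) / real n)"
    proof -
      have "real (k * m + m) / real (n * m) = (real (Suc k) * real m) / (real n * real m)"
        by (simp add: algebra_simps)
      also have "\<dots> = real (Suc k) / real n" using m by simp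
      finally show ?thesis unfolding x_def by simp
    qed
    finally show "sum f {k*m..<k*m+m} = \<phi> (p (real k / real n)) (p (real (Suc k) / real n))" .
  qed
  finally show "path_sum \<phi> (n * m) p = path_sum \<phi> n p" .
qed

lemma sum_lessThan_add:
  fixes f :: "nat \<Rightarrow> 'a::comm_monoid_add"
  shows "(\<Sum>k<m+n. f k) = (\<Sum>k<m. f k) + (\<Sum>k<n. f (m + k))"
  by (induction n) (simp_all add: add.assoc)

text \<open>Both halves of \<open>p +++ q\<close> run at double speed, so \<open>2 * l\<close> parts
  cut \<open>p\<close> and \<open>q\<close> into \<open>l\<close> parts each; \<open>l\<close> has
  to be a multiple of both \<open>m\<close> and \<open>n\<close>.\<close>

lemma has_path_sum_join:
  assumes "has_path_sum \<phi> p s" "has_path_sum \<phi> q t" "pathfinish p = pathstart q"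
  shows "has_path_sum \<phi> (p +++ q) (s + t)"
proof -
  obtain m n where mn: "m > 0" "n > 0" and m: "\<forall>k>0. path_sum \<phi> (m * k) p = s"
      and n: "\<forall>k>0. path_sum \<phi> (n * k) q = t"
    using assms unfolding has_path_sum_def by blast
  have "path_sum \<phi> (2 * m * n * k) (p +++ q) = s + t" if k: "k > 0" for k
  proof -
    define l where "l = m * n * k"
    have l: "l > 0" using mn k by (simp add: l_def)
    define r where "r = p +++ q"
    have r1: "r (real i / real (2*l)) = p (real i / real l)" if "i \<le> l" for i
      using that l by (simp add: r_def joinpaths_def field_simps)
    \<comment> \<open>At \<open>i = 0\<close> the joined path is still on its first half, so the
      midpoint comes from \<open>p\<close> and is rewritten by the matching endpoints.\<close>
    have r2: "r (real (l + i) / real (2*l)) = q (real i / real l)" for i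
    proof (cases "i = 0")
      case True
      then show ?thesis using l assms(3) r1[of l] by (simp add: pathfinish_def pathstart_def)
    next
      case False
      have "2 * (real (l + i) / real (2*l)) - 1 = real i / real l"
        using l by (simp add: field_simps)
      moreover have "\<not> real (l + i) / real (2*l) \<le> 1/2"
        using l False by (simp add: field_simps)
      ultimately show ?thesis unfolding r_def joinpaths_def by simp
    qed
    have "path_sum \<phi> (2 * l) r =
        (\<Sum>i<l. \<phi> (r (real i / real (2*l))) (r (real (Suc i) / real (2*l)))) +
        (\<Sum>i<l. \<phi> (r (real (l+i) / real (2*l))) (r (real (l + Suc i) / real (2*l))))"
      unfolding path_sum_def mult_2[of l] sum_lessThan_add by (simp only: add_Suc_right)
    also have "\<dots> = path_sum \<phi> l p + path_sum \<phi> l q"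
      unfolding path_sum_def r2 by (simp add: r1 del: of_nat_Suc of_nat_mult)
    also have "path_sum \<phi> l p = s" using m mn k by (simp add: l_def mult.assoc)
    also have "path_sum \<phi> l q = t" using n mn k
      by (metis l_def mult.assoc mult.left_commute nat_0_less_mult_iff)
    finally show ?thesis by (simp add: l_def r_def mult.assoc)
  qed
  moreover have "2 * m * n > 0" using mn by simp
  ultimately show ?thesis unfolding has_path_sum_def by blast
qed

text \<open>Preimages of cover members are open only relative to \<open>S\<close>, so the covering
  lemma is applied to all open \<open>D\<close> whose trace on \<open>S\<close> is mapped into one
  member.\<close>

lemma Lebesgue_number_continuous_image:
  fixes h :: "'a::metric_space \<Rightarrow> 'b::topological_space"
  assumes "compact S" "continuous_on S h" "h ` S \<subseteq> X"
    and "\<And>U. U \<in> \<C> \<Longrightarrow> openin (top_of_set X) U" "X \<subseteq> \<Union>\<C>" "X \<noteq> {}"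
  obtains \<delta> where "\<delta> > 0" "\<And>T. T \<subseteq> S \<Longrightarrow> diameter T < \<delta> \<Longrightarrow> \<exists>U\<in>\<C>. h ` T \<subseteq> U"
proof -
  define \<D> where "\<D> = {D. open D \<and> (\<exists>U\<in>\<C>. h ` (S \<inter> D) \<subseteq> U)}"
  have cover: "S \<subseteq> \<Union>\<D>"
  proof
    fix x
    assume x: "x \<in> S"
    then obtain U where U: "U \<in> \<C>" "h x \<in> U" using assms(3,5) by blast
    have "openin (top_of_set S) (S \<inter> h -` U)"
      using continuous_openin_preimage[of S h X U] assms(2,3,4) U(1) by auto
    then obtain D where D: "open D" "S \<inter> h -` U = S \<inter> D"
      unfolding openin_open by blast
    then have "D \<in> \<D>" "x \<in> D" using U x unfolding \<D>_def by auto
    then show "x \<in> \<Union>\<D>" by blast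
  qed
  have "\<C> \<noteq> {}" using assms(5,6) by blast
  then have ne: "\<D> \<noteq> {}" unfolding \<D>_def by (force intro: exI[of _ "{}"])
  obtain \<delta> where \<delta>: "0 < \<delta>" "\<And>T. \<lbrakk>T \<subseteq> S; diameter T < \<delta>\<rbrakk> \<Longrightarrow> \<exists>D \<in> \<D>. T \<subseteq> D"
    using Lebesgue_number_lemma[OF assms(1) ne cover] unfolding \<D>_def by blast
  show ?thesis
  proof (rule that[OF \<delta>(1)])
    fix T
    assume T: "T \<subseteq> S" "diameter T < \<delta>"
    then obtain D where D: "D \<in> \<D>" "T \<subseteq> D"
      using \<delta>(2) by blast
    then obtain U where U: "U \<in> \<C>" "h ` (S \<inter> D) \<subseteq> U"
      unfolding \<D>_def by blast
    moreover have "h ` T \<subseteq> h ` (S \<inter> D)" using T(1) D(2) by (intro image_mono) simp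
    ultimately show "\<exists>U\<in>\<C>. h ` T \<subseteq> U" by (meson order_trans)
  qed
qed

section \<open>Homotopy invariance and exactness\<close>

context
  fixes X :: "'a::topological_space set" and \<C> :: "'a set set"
    and \<phi> :: "'a \<Rightarrow> 'a \<Rightarrow> 'b::ab_group_add"
  assumes open_cover: "\<And>U. U \<in> \<C> \<Longrightarrow> openin (top_of_set X) U" "X \<subseteq> \<Union>\<C>"
    and cocycle: "\<And>U. U \<in> \<C> \<Longrightarrow> cocycle_on U \<phi>"
begin

lemma path_sum_exists:
  assumes "path p" "path_image p \<subseteq> X"
  obtains s where "has_path_sum \<phi> p s"
proof -
  have "X \<noteq> {}" using assms(2) by auto
  then obtain \<delta> where \<delta>: "\<delta> > 0" "\<And>T. T \<subseteq> {0..1} \<Longrightarrow> diameter T < \<delta> \<Longrightarrow> \<exists>U\<in>\<C>. p ` T \<subseteq> U"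
    using Lebesgue_number_continuous_image[of "{0..1}" p X \<C>] assms open_cover
    unfolding path_def path_image_def by auto
  obtain n where n: "n > 0" "1 / real n < \<delta>"
    using \<delta>(1) by (metis nat_approx_posE of_nat_Suc zero_less_Suc)
  have "\<exists>U. cocycle_on U \<phi> \<and> p ` {real k / real n .. real (Suc k) / real n} \<subseteq> U" if "k < n" for k
  proof -
    have "real k / real n \<le> real (Suc k) / real n" by (simp add: divide_right_mono)
    moreover have "real (Suc k) / real n - real k / real n = 1 / real n" 
      by (simp add: diff_divide_distrib[symmetric])
    ultimately have "diameter {real k / real n .. real (Suc k) / real n} < \<delta>"
      using n(2) by (simp add: diameter_closed_interval)
    moreover have "{real k / real n .. real (Suc k) / real n} \<subseteq> {0..1}"
      using that n(1) by auto
    ultimately show ?thesis using \<delta>(2) cocycle by blast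
  qed
  then show ?thesis using has_path_sum_refine[OF n(1)] that by blast
qed

text \<open>On a fine grid in the homotopy square neighbouring rows have equal sums: their
  difference telescopes to increments along the two vertical sides, which coincide because every
  stage is a loop. The last row is constant.\<close>

lemma has_path_sum_null_homotopic:
  assumes "homotopic_loops X p (\<lambda>_. c)" "has_path_sum \<phi> p s"
  shows "s = 0"
proof -
  obtain h where h: "continuous_on ({0..1::real} \<times> {0..1::real}) h"
      "h \<in> ({0..1} \<times> {0..1}) \<rightarrow> X" "\<And>x. x \<in> {0..1} \<Longrightarrow> h (0, x) = p x"
      "\<And>x. x \<in> {0..1} \<Longrightarrow> h (1, x) = c"
      "\<And>t. t \<in> {0..1} \<Longrightarrow> h (t, 1) = h (t, 0)"
    using assms(1) unfolding homotopic_loops by (auto simp: pathstart_def pathfinish_def)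
  have "h (0, 0) \<in> X" using h(2) by auto
  then have "X \<noteq> {}" by blast
  moreover have "compact ({0..1::real} \<times> {0..1::real})" by (intro compact_Times compact_Icc)
  ultimately obtain \<delta> where \<delta>: "\<delta> > 0"
      "\<And>T. T \<subseteq> {0..1} \<times> {0..1} \<Longrightarrow> diameter T < \<delta> \<Longrightarrow> \<exists>U\<in>\<C>. h ` T \<subseteq> U"
    using Lebesgue_number_continuous_image[of "{0..1::real} \<times> {0..1::real}" h X \<C>] h(1,2) open_cover
    by blast
  obtain n where n: "n > 0" "\<forall>m>0. path_sum \<phi> (n * m) p = s"
    using assms(2) unfolding has_path_sum_def by blast
  obtain m where m: "m > 0" "1 / real m < \<delta> / 3"
    using \<delta>(1) by (metis nat_approx_posE of_nat_Suc zero_less_Suc divide_pos_pos zero_less_numeral)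
  \<comment> \<open>As a multiple of \<open>n\<close>, \<open>N\<close> computes \<open>s\<close>
    along the first row; the factor \<open>m\<close> makes the cells small, their diameter being at
    most the sum \<open>2 / N\<close> of the side lengths.\<close>
  define N where "N = n * m"
  have N: "N > 0" using n(1) m(1) by (simp add: N_def)
  have "1 / real N \<le> 1 / real m" using n(1) m(1) by (simp add: N_def field_simps)
  then have N\<delta>: "2 / real N < \<delta>" using m(2) \<delta>(1) by (simp add: field_simps)
  define x where "x i k = h (real i / real N, real k / real N)" for i k
  define row where "row i = (\<Sum>k<N. \<phi> (x i k) (x i (Suc k)))" for i
  have step: "row i = row (Suc i)" if i: "i < N" for i
  proof -
    \<comment> \<open>The cell lies in one member of the cover, so both ways round from
      \<open>x i k\<close> to the opposite corner give the same increment.\<close>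
    have cell: "\<phi> (x i k) (x i (Suc k)) - \<phi> (x (Suc i) k) (x (Suc i) (Suc k)) =
        \<phi> (x i k) (x (Suc i) k) - \<phi> (x i (Suc k)) (x (Suc i) (Suc k))" if k: "k < N" for k
    proof -
      define Q where "Q = {real i / real N .. real (Suc i) / real N} \<times> {real k / real N .. real (Suc k) / real N}"
      have le: "real j / real N \<le> real (Suc j) / real N" for j by (simp add: divide_right_mono)
      have wid: "real (Suc j) / real N - real j / real N = 1 / real N" for j
        by (simp add: diff_divide_distrib[symmetric])
      have "diameter Q \<le> 2 / real N"
      proof (rule diameter_le)
        show "Q \<noteq> {} \<or> 0 \<le> 2 / real N" by simp
        fix a b assume "a \<in> Q" "b \<in> Q"
        then have "\<bar>fst a - fst b\<bar> \<le> 1 / real N" "\<bar>snd a - snd b\<bar> \<le> 1 / real N"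
          unfolding Q_def using wid[of i] wid[of k] by auto
        moreover have "norm (a - b) \<le> \<bar>fst (a - b)\<bar> + \<bar>snd (a - b)\<bar>"
          using norm_Pair_le[of "fst (a-b)" "snd (a-b)"] unfolding prod.collapse by simp
        ultimately show "norm (a - b) \<le> 2 / real N" by simp
      qed
      moreover have "Q \<subseteq> {0..1} \<times> {0..1}"
      proof -
        have "{real j / real N .. real (Suc j) / real N} \<subseteq> {0..1}" if "j < N" for j
          using that N by auto
        then show ?thesis using i k unfolding Q_def by blast
      qed
      ultimately obtain U where U: "U \<in> \<C>" "h ` Q \<subseteq> U"
        using \<delta>(2)[of Q] N\<delta> by auto
      have "x i k \<in> U" "x i (Suc k) \<in> U" "x (Suc i) k \<in> U" "x (Suc i) (Suc k) \<in> U"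
        using U(2) le unfolding x_def Q_def by (auto simp: image_subset_iff)
      then have "\<phi> (x i k) (x i (Suc k)) + \<phi> (x i (Suc k)) (x (Suc i) (Suc k)) = \<phi> (x i k) (x (Suc i) (Suc k))"
        "\<phi> (x i k) (x (Suc i) k) + \<phi> (x (Suc i) k) (x (Suc i) (Suc k)) = \<phi> (x i k) (x (Suc i) (Suc k))"
        using cocycle[OF U(1)] unfolding cocycle_on_def by auto
      then have "\<phi> (x i k) (x i (Suc k)) + \<phi> (x i (Suc k)) (x (Suc i) (Suc k)) =
          \<phi> (x i k) (x (Suc i) k) + \<phi> (x (Suc i) k) (x (Suc i) (Suc k))" by simp
      then show ?thesis by (simp add: algebra_simps)
    qed
    have "row i - row (Suc i) = (\<Sum>k<N. \<phi> (x i k) (x (Suc i) k) - \<phi> (x i (Suc k)) (x (Suc i) (Suc k)))"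
      unfolding row_def sum_subtractf[symmetric] by (intro sum.cong refl cell) auto
    also have "\<dots> = \<phi> (x i 0) (x (Suc i) 0) - \<phi> (x i N) (x (Suc i) N)"
      by (rule sum_lessThan_telescope')
    also have "\<dots> = 0" using h(5)[of "real i / real N"] h(5)[of "real (Suc i) / real N"] i N
      by (simp add: x_def del: of_nat_Suc)
    finally show ?thesis by simp
  qed
  have "row 0 = row i" if "i \<le> N" for i using that
    by (induction i) (use step in auto)
  then have "row 0 = row N" by blast
  moreover have "row 0 = path_sum \<phi> N p"
    unfolding row_def path_sum_def by (rule sum.cong) (use N in \<open>auto simp: x_def h(3) divide_simps simp del: of_nat_Suc\<close>)
  moreover have "c \<in> X" using h(2) h(4)[of 0] by force
  then obtain U where "U \<in> \<C>" "c \<in> U" using open_cover(2) by blast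
  then have "\<phi> c c = 0" using cocycle_on_refl[OF cocycle] by blast
  then have "row N = 0"
    unfolding row_def using N by (intro sum.neutral) (auto simp: x_def h(4) divide_simps simp del: of_nat_Suc)
  ultimately show ?thesis using n(2) m(1) unfolding N_def by simp
qed

text \<open>The vanishing of the first Alexander--Spanier cohomology of a simply connected space.\<close>

lemma simply_connected_cocycle_exact:
  assumes sc: "simply_connected X" and pc: "\<And>U. U \<in> \<C> \<Longrightarrow> path_connected U"
  obtains f where "\<And>U a b. U \<in> \<C> \<Longrightarrow> a \<in> U \<Longrightarrow> b \<in> U \<Longrightarrow> \<phi> a b = f b - f a"
proof -
  \<comment> \<open>Points joined by a path have equal predicates under \<open>SOME\<close>, hence
    the same base point.\<close>
  define base where "base a = (SOME c. path_component X a c)" for a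
  have base: "path_component X a (base a)" if "a \<in> X" for a
    unfolding base_def by (rule someI[of _ a]) (use that in \<open>simp add: path_component_refl_eq\<close>)
  have "\<forall>a\<in>X. \<exists>p. path p \<and> path_image p \<subseteq> X \<and> pathstart p = base a \<and> pathfinish p = a"
    using path_component_sym[OF base] unfolding path_component_def by blast
  then obtain p where p: "path (p a)" "path_image (p a) \<subseteq> X" "pathstart (p a) = base a" "pathfinish (p a) = a"
    if "a \<in> X" for a by (metis (no_types))
  have "\<forall>a\<in>X. \<exists>q. path q \<and> path_image q \<subseteq> X \<and> pathstart q = a \<and> pathfinish q = base a"
    using base unfolding path_component_def by blast
  then obtain q where q: "path (q a)" "path_image (q a) \<subseteq> X" "pathstart (q a) = a" "pathfinish (q a) = base a"
    if "a \<in> X" for a by (metis (no_types))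
  have "\<forall>a\<in>X. \<exists>s. has_path_sum \<phi> (p a) s"
    using path_sum_exists[OF p(1,2)] by metis
  then obtain f where f: "has_path_sum \<phi> (p a) (f a)" if "a \<in> X" for a
    by (metis (no_types))
  have loop: "s = 0" if "path l" "path_image l \<subseteq> X" "pathfinish l = pathstart l" "has_path_sum \<phi> l s" for l s
  proof -
    have "pathstart l \<in> X" using that(2) by auto
    then have "homotopic_loops X l (\<lambda>_. pathstart l)"
      using that(1,2,3) by (intro sc[unfolded simply_connected_def, rule_format])
        (auto simp: path_def path_image_def pathstart_def pathfinish_def)
    then show ?thesis using has_path_sum_null_homotopic[OF _ that(4)] by blast
  qed
  have "\<phi> a b = f b - f a" if U: "U \<in> \<C>" "a \<in> U" "b \<in> U" for U a b
  proof -
    have UX: "U \<subseteq> X" using open_cover(1)[OF U(1)] openin_imp_subset by blast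
    then have X: "a \<in> X" "b \<in> X" using U by auto
    obtain r where r: "path r" "path_image r \<subseteq> U" "pathstart r = a" "pathfinish r = b"
      using pc[OF U(1)] U(2,3) unfolding path_connected_def by blast
    then have "path_component X a b" using UX unfolding path_component_def by blast
    then have "path_component X a = path_component X b"
      by (intro ext iffI) (blast intro: path_component_sym path_component_trans)+
    then have bb: "base a = base b" by (simp add: base_def)
    obtain t where t: "has_path_sum \<phi> (q b) t" using path_sum_exists[OF q(1,2)[OF X(2)]] by blast
    have rs: "has_path_sum \<phi> r (\<phi> a b)"
      using has_path_sum_within[OF cocycle[OF U(1)]] r by (auto simp: path_image_def pathstart_def pathfinish_def)
    note pa = p[OF X(1)] and pb = p[OF X(2)] and qb = q[OF X(2)]
    \<comment> \<open>The same return path \<open>q b\<close> closes up both \<open>p b\<close> and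
      \<open>p a\<close> followed by \<open>r\<close>; comparing the two vanishing loop sums leaves
      \<open>f a + \<phi> a b = f b\<close>.\<close>
    have "f b + t = 0"
    proof (rule loop[of "p b +++ q b"])
      show "has_path_sum \<phi> (p b +++ q b) (f b + t)"
        using has_path_sum_join[OF f[OF X(2)] t] pb qb by simp
      show "path_image (p b +++ q b) \<subseteq> X"
        using path_image_join_subset[of "p b" "q b"] pb(2) qb(2) by blast
    qed (use pb qb in simp_all)
    moreover have "f a + (\<phi> a b + t) = 0"
    proof (rule loop[of "p a +++ (r +++ q b)"])
      have "has_path_sum \<phi> (r +++ q b) (\<phi> a b + t)"
        using has_path_sum_join[OF rs t] r qb by simp
      moreover have "pathfinish (p a) = pathstart (r +++ q b)"
        using pa r by simp
      ultimately show "has_path_sum \<phi> (p a +++ (r +++ q b)) (f a + (\<phi> a b + t))"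
        by (rule has_path_sum_join[OF f[OF X(1)]])
      show "path_image (p a +++ (r +++ q b)) \<subseteq> X"
        using path_image_join_subset[of "p a" "r +++ q b"] path_image_join_subset[of r "q b"]
          pa(2) r(2) qb(2) UX by blast
    qed (use pa qb r bb in simp_all)
    ultimately have "f a + \<phi> a b + t = f b + t" by (simp add: add.assoc)
    then have "f a + \<phi> a b = f b" by simp
    then show ?thesis by (metis add_diff_cancel_left')
  qed
  then show ?thesis using that by blast
qed

end

section \<open>Simplicial complexes\<close>

lemma continuous_on_coordinate [continuous_intros]:
  "continuous_on S (\<lambda>x::'i \<Rightarrow> 'a::topological_space. x i)"
  by (rule continuous_on_subset[OF continuous_on_product_coordinates]) simp

lemma openin_superlevel:
  fixes f :: "'a::topological_space \<Rightarrow> real"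
  assumes "continuous_on X f"
  shows "openin (top_of_set X) {x \<in> X. c < f x}"
proof -
  have "{x \<in> X. c < f x} = X \<inter> f -` {c<..}" by auto
  then show ?thesis using continuous_openin_preimage_gen[OF assms open_greaterThan[of c]] by simp
qed

definition carrier :: "('v \<Rightarrow> real) \<Rightarrow> 'v set" where
  "carrier x = {v. x v \<noteq> 0}"

definition open_star :: "'v set set \<Rightarrow> 'v \<Rightarrow> ('v \<Rightarrow> real) set" where
  "open_star K v = {x \<in> underlying_space K. 0 < x v}"

definition edge_point :: "'v \<Rightarrow> 'v \<Rightarrow> real \<Rightarrow> 'v \<Rightarrow> real" where
  "edge_point v w t = (\<lambda>u. if u = v then 1 - t else if u = w then t else 0)"

definition vertex_point :: "'v \<Rightarrow> 'v \<Rightarrow> real" where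
  "vertex_point v = (\<lambda>u. if u = v then 1 else 0)"

locale simplicial_complex =
  fixes K :: "'v set set"
  assumes complex: "abstract_simplicial_complex K"
begin

abbreviation X where "X \<equiv> underlying_space K"

lemma face: "s \<in> K \<Longrightarrow> t \<subseteq> s \<Longrightarrow> t \<noteq> {} \<Longrightarrow> t \<in> K"
  and finite_simplex: "s \<in> K \<Longrightarrow> finite s"
  and simplex_nonempty: "s \<in> K \<Longrightarrow> s \<noteq> {}"
  using complex unfolding abstract_simplicial_complex_def by blast+

lemma carrier_simplex: "x \<in> X \<Longrightarrow> carrier x \<in> K"
  and nonneg: "x \<in> X \<Longrightarrow> 0 \<le> x v"
  and sum_carrier: "x \<in> X \<Longrightarrow> sum x (carrier x) = 1"
  unfolding underlying_space_def carrier_def by auto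

lemma mem_carrier: "x \<in> X \<Longrightarrow> v \<in> carrier x \<longleftrightarrow> 0 < x v"
  using nonneg[of x v] unfolding carrier_def by auto

lemma sum_coordinates:
  assumes "x \<in> X" "finite F" "carrier x \<subseteq> F"
  shows "sum x F = 1"
proof -
  have "sum x F = sum x (carrier x)"
    using assms(2,3) by (intro sum.mono_neutral_right) (auto simp: carrier_def)
  then show ?thesis using sum_carrier[OF assms(1)] by simp
qed

lemma underlying_spaceI:
  assumes "\<And>v. 0 \<le> x v" "finite F" "F \<in> K" "carrier x \<subseteq> F" "sum x F = 1"
  shows "x \<in> X"
proof -
  have s: "sum x F = sum x (carrier x)"
    using assms by (intro sum.mono_neutral_right) (auto simp: carrier_def)
  then have "carrier x \<noteq> {}" using assms(5) by auto
  then have "carrier x \<in> K" using face[OF assms(3,4)] by simp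
  then show ?thesis using assms s unfolding underlying_space_def carrier_def by simp
qed

lemma carrier_vertex_point: "carrier (vertex_point v) = {v}"
  by (auto simp: carrier_def vertex_point_def)

lemma vertex_point_in: "{v} \<in> K \<Longrightarrow> vertex_point v \<in> X"
  by (rule underlying_spaceI[of _ "{v}"]) (auto simp: carrier_vertex_point, auto simp: vertex_point_def)

lemma vertex_point_unique:
  assumes "x \<in> X" "carrier x \<subseteq> {v}"
  shows "x = vertex_point v"
proof
  fix u
  have "x v = 1" using sum_coordinates[OF assms(1) _ assms(2)] by simp
  then show "x u = vertex_point v u"
    using assms(2) by (auto simp: vertex_point_def carrier_def)
qed

lemma edge_point_in:
  assumes "{v, w} \<in> K" "v \<noteq> w" "0 \<le> t" "t \<le> 1"
  shows "edge_point v w t \<in> X"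
  by (rule underlying_spaceI[of _ "{v, w}"]) (use assms in \<open>auto simp: carrier_def edge_point_def\<close>)

lemma continuous_on_edge_point: "continuous_on S (edge_point v w)"
proof (rule continuous_on_coordinatewise_then_product)
  fix i
  show "continuous_on S (\<lambda>t. edge_point v w t i)"
    unfolding edge_point_def by (cases "i = v"; cases "i = w") (auto intro!: continuous_intros)
qed

lemma edge_point_0: "v \<noteq> w \<Longrightarrow> edge_point v w 0 = vertex_point v"
  by (auto simp: edge_point_def vertex_point_def)

text \<open>Supplies points near a vertex or an edge midpoint on a chosen side, as the separation
  arguments below require.\<close>

lemma edge_point_near:
  assumes "{v, w} \<in> K" "v \<noteq> w" "0 \<le> t" "t < 1" "openin (top_of_set X) U" "edge_point v w t \<in> U"
  obtains s where "t < s" "s < 1" "edge_point v w s \<in> U"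
proof -
  have im: "edge_point v w \<in> {0..1} \<rightarrow> X" using edge_point_in assms by auto
  have "openin (top_of_set {0..1}) ({0..1} \<inter> edge_point v w -` U)"
    using continuous_openin_preimage[OF continuous_on_edge_point _ assms(5)] im by auto
  moreover have "t \<in> {0..1} \<inter> edge_point v w -` U" using assms by auto
  ultimately obtain e where e: "e > 0" "\<And>s. s \<in> {0..1} \<Longrightarrow> dist s t < e \<Longrightarrow> edge_point v w s \<in> U"
    unfolding openin_euclidean_subtopology_iff by (metis (no_types, lifting) IntD2 vimage_eq)
  define s where "s = t + min (e/2) ((1-t)/2)"
  have "t < s" "s < 1" using e(1) assms(4) by (auto simp: s_def min_def field_simps)
  moreover have "edge_point v w s \<in> U"
    using e(1) assms(3,4) by (intro e(2)) (auto simp: s_def dist_real_def min_def field_simps)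
  ultimately show ?thesis using that by blast
qed

lemma open_star_open: "openin (top_of_set X) (open_star K v)"
  unfolding open_star_def by (intro openin_superlevel continuous_intros)

lemma open_star_cover: "x \<in> X \<Longrightarrow> \<exists>v. {v} \<in> K \<and> x \<in> open_star K v"
proof -
  assume x: "x \<in> X"
  then obtain v where v: "v \<in> carrier x" using simplex_nonempty carrier_simplex by blast
  then have "{v} \<in> K" using face[OF carrier_simplex[OF x]] by auto
  then show ?thesis using v x by (auto simp: mem_carrier open_star_def)
qed

lemma path_connected_open_star: "path_connected (open_star K v)"
proof -
  have "path_component (open_star K v) x (vertex_point v)" if x: "x \<in> open_star K v" for x
  proof -
    have xX: "x \<in> X" and pos: "0 < x v" using x by (auto simp: open_star_def)
    then have v: "v \<in> carrier x" by (simp add: mem_carrier)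
    define p where "p t u = (1 - t) * x u + t * vertex_point v u" for t u
    have "path p" unfolding path_def p_def
      by (intro continuous_on_coordinatewise_then_product continuous_intros)
    moreover have "p t \<in> open_star K v" if t: "t \<in> {0..1}" for t
    proof -
      have "p t \<in> X"
      proof (rule underlying_spaceI[of _ "carrier x"])
        show "0 \<le> p t u" for u using nonneg[OF xX] t by (auto simp: p_def vertex_point_def)
        show "carrier (p t) \<subseteq> carrier x" using v by (auto simp: carrier_def p_def vertex_point_def)
        have "sum (vertex_point v) (carrier x) = 1"
          using v finite_simplex[OF carrier_simplex[OF xX]] by (simp add: vertex_point_def)
        then show "sum (p t) (carrier x) = 1"
          unfolding p_def by (simp add: sum.distrib sum_distrib_left[symmetric] sum_carrier[OF xX])
      qed (use finite_simplex carrier_simplex xX in auto)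
      moreover have "0 < p t v"
      proof (cases "t = 1")
        case False
        then have "0 < (1 - t) * x v" using t pos by simp
        then show ?thesis using t by (simp add: p_def vertex_point_def)
      qed (simp add: p_def vertex_point_def)
      ultimately show ?thesis by (simp add: open_star_def)
    qed
    ultimately show ?thesis unfolding path_component_def
      by (intro exI[of _ p]) (auto simp: path_image_def pathstart_def pathfinish_def p_def)
  qed
  then show ?thesis unfolding path_connected_component
    by (meson path_component_sym path_component_trans)
qed

text \<open>Each point is represented by a vertex of its carrier, and \<open>g\<close> between
  representatives becomes a cocycle on every open star, where all carriers share a vertex. The
  hypothesis includes degenerate triples, hence \<open>g u u = 0\<close> on vertices and
  antisymmetry on edges.\<close>

lemma simply_connected_cochain_exact:
  fixes g :: "'v \<Rightarrow> 'v \<Rightarrow> 'b::ab_group_add"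
  assumes "simply_connected X"
    and g: "\<And>u v w. {u, v, w} \<in> K \<Longrightarrow> g u v + g v w = g u w"
  obtains h where "\<And>v w. {v, w} \<in> K \<Longrightarrow> g v w = h w - h v"
proof -
  define rep where "rep x = (SOME v. v \<in> carrier x)" for x :: "'v \<Rightarrow> real"
  have rep: "rep x \<in> carrier x" if "x \<in> X" for x
    unfolding rep_def using simplex_nonempty[OF carrier_simplex[OF that]] by (simp add: some_in_eq)
  \<comment> \<open>The representatives of \<open>x\<close> and \<open>y\<close> need not span a
    simplex, so the increment goes through a vertex common to both carriers; additivity of
    \<open>g\<close> on simplices makes it independent of that vertex.\<close>
  define \<phi> where "\<phi> x y = (let w = SOME w. w \<in> carrier x \<inter> carrier y in g (rep x) w + g w (rep y))" for x y
  have g3: "g u v + g v w = g u w" if "x \<in> X" "u \<in> carrier x" "v \<in> carrier x" "w \<in> carrier x" for u v w x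
    using that by (intro g face[OF carrier_simplex]) auto
  have g0: "g u u = 0" if "x \<in> X" "u \<in> carrier x" for u x
    using g3[of x u u u] that by simp
  have \<phi>: "\<phi> x y = g (rep x) w + g w (rep y)"
    if "x \<in> X" "y \<in> X" "w \<in> carrier x" "w \<in> carrier y" for x y w
  proof -
    define w' where "w' = (SOME w. w \<in> carrier x \<inter> carrier y)"
    have "w' \<in> carrier x \<inter> carrier y"
      unfolding w'_def by (rule someI[of _ w]) (use that in auto)
    then have "g (rep x) w = g (rep x) w' + g w' w" "g w' w + g w (rep y) = g w' (rep y)"
      using g3 rep that by simp_all
    then have "g (rep x) w + g w (rep y) = g (rep x) w' + g w' (rep y)" by (simp add: add.assoc)
    then show ?thesis by (simp add: \<phi>_def w'_def Let_def)
  qed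
  have "cocycle_on (open_star K w) \<phi>" for w
    unfolding cocycle_on_def
  proof safe
    fix a b c
    assume "a \<in> open_star K w" "b \<in> open_star K w" "c \<in> open_star K w"
    then have X: "a \<in> X" "b \<in> X" "c \<in> X" and w: "w \<in> carrier a" "w \<in> carrier b" "w \<in> carrier c"
      by (auto simp: open_star_def mem_carrier)
    have "g w (rep b) + g (rep b) w = 0"
      using g3[OF X(2) w(2) rep[OF X(2)] w(2)] g0[OF X(2) w(2)] by simp
    then have "g (rep a) w + g w (rep b) + (g (rep b) w + g w (rep c)) = g (rep a) w + g w (rep c)"
      by (metis add.assoc add.right_neutral add.commute)
    then show "\<phi> a b + \<phi> b c = \<phi> a c" using \<phi> X w by simp
  qed
  note cocycle = this
  obtain f where "\<And>U a b. U \<in> open_star K ` {w. {w} \<in> K} \<Longrightarrow> a \<in> U \<Longrightarrow> b \<in> U \<Longrightarrow> \<phi> a b = f b - f a"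
  proof (rule simply_connected_cocycle_exact[of "open_star K ` {w. {w} \<in> K}" X \<phi>])
    show "X \<subseteq> \<Union> (open_star K ` {w. {w} \<in> K})" using open_star_cover by blast
  qed (use assms(1) open_star_open path_connected_open_star cocycle in auto)
  then have f: "\<phi> a b = f b - f a" if "{w} \<in> K" "a \<in> open_star K w" "b \<in> open_star K w" for w a b
    using that by blast
  have "g v w = f (vertex_point w) - f (vertex_point v)" if vw: "{v, w} \<in> K" for v w
  proof -
    have K: "{v} \<in> K" "{w} \<in> K" by (rule face[OF vw]; simp)+
    note vX = vertex_point_in[OF K(1)] and wX = vertex_point_in[OF K(2)]
    have r: "rep (vertex_point v) = v" "rep (vertex_point w) = w"
      using rep[OF vX] rep[OF wX] by (simp_all add: carrier_vertex_point)
    show ?thesis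
    proof (cases "v = w")
      case True
      then show ?thesis using g0[OF vX] by (simp add: carrier_vertex_point)
    next
      case False
      \<comment> \<open>No open star contains both vertex points, whereas the midpoint lies in the
        open stars of \<open>v\<close> and of \<open>w\<close>.\<close>
      define m where "m = edge_point v w (1/2)"
      have m: "m \<in> X" unfolding m_def using edge_point_in[OF vw False] by simp
      have c: "v \<in> carrier m" "w \<in> carrier m"
        using False by (auto simp: carrier_def m_def edge_point_def)
      have "\<phi> (vertex_point v) m = f m - f (vertex_point v)"
        by (rule f[OF K(1)]) (use vX m c in \<open>auto simp: open_star_def mem_carrier[symmetric] carrier_vertex_point\<close>)
      moreover have "\<phi> m (vertex_point w) = f (vertex_point w) - f m"
        by (rule f[OF K(2)]) (use wX m c in \<open>auto simp: open_star_def mem_carrier[symmetric] carrier_vertex_point\<close>)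
      moreover have "\<phi> (vertex_point v) m = g v (rep m)"
        using \<phi>[OF vX m, of v] c r g0[OF vX, of v] by (simp add: carrier_vertex_point)
      moreover have "\<phi> m (vertex_point w) = g (rep m) w"
        using \<phi>[OF m wX, of w] c r g0[OF wX, of w] by (simp add: carrier_vertex_point)
      moreover have "g v (rep m) + g (rep m) w = g v w"
        using g3[OF m c(1) rep[OF m] c(2)] .
      ultimately have "g v w = (f m - f (vertex_point v)) + (f (vertex_point w) - f m)" by simp
      then show ?thesis by simp
    qed
  qed
  then show ?thesis using that[of "\<lambda>v. f (vertex_point v)"] by blast
qed

end

section \<open>Two-manifolds with boundary\<close>

abbreviation half_plane :: "complex set" where
  "half_plane \<equiv> {w. 0 \<le> Im w}"

lemma two_manifold_chart:
  assumes "two_manifold_with_boundary S" "x \<in> S" "openin (top_of_set S) A" "x \<in> A"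
  obtains U W f g where "openin (top_of_set S) U" "x \<in> U" "U \<subseteq> A" "openin (top_of_set half_plane) W"
    "homeomorphism U W f g"
proof -
  obtain U W where U: "openin (top_of_set S) U" "x \<in> U" and W: "openin (top_of_set half_plane) W"
      and "U homeomorphic W"
    using assms(1,2) unfolding two_manifold_with_boundary_def by blast
  then obtain f g where fg: "homeomorphism U W f g" unfolding homeomorphic_def by blast
  have UA: "openin (top_of_set U) (U \<inter> A)"
    using assms(3) openin_subset_trans[of S "U \<inter> A" U] U(1) openin_Int openin_imp_subset by blast
  have "openin (top_of_set W) (f ` (U \<inter> A))"
    by (rule homeomorphism_imp_open_map[OF fg UA])
  then have "openin (top_of_set half_plane) (f ` (U \<inter> A))" using W openin_trans by blast
  moreover have "openin (top_of_set S) (U \<inter> A)" using U(1) assms(3) by blast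
  moreover have "homeomorphism (U \<inter> A) (f ` (U \<inter> A)) f g"
    by (rule homeomorphism_of_subsets[OF fg]) auto
  ultimately show ?thesis using that[of "U \<inter> A" "f ` (U \<inter> A)" f g] U(2) assms(4) by blast
qed

lemma openin_half_plane_contains_ball:
  assumes "openin (top_of_set half_plane) W" "w \<in> W"
  obtains r where "0 < r" "cball w r \<inter> half_plane \<subseteq> W"
  using assms openin_contains_cball[of half_plane W] by blast

text \<open>A convex set of affine dimension other than 1 stays connected when a point is removed.
  As \<open>w\<close> may lie on the boundary line, an upward shift by \<open>r/2\<close> provides
  the interior point that makes the dimension 2.\<close>

lemma half_disc:
  assumes "w \<in> half_plane" "0 < r"
  shows "connected (ball w r \<inter> half_plane - {w})"
    and "\<exists>w'. w' \<in> ball w r \<inter> half_plane \<and> w' \<noteq> w"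
proof -
  define w' where "w' = w + Complex 0 (r/2)"
  have n: "cmod (Complex 0 (r/2)) = r/2" using assms(2) by (simp add: cmod_def)
  have "w' \<in> ball w r \<inter> {w. 0 < Im w}"
    using assms n by (simp add: w'_def dist_norm norm_minus_commute)
  moreover have "open (ball w r \<inter> {w. 0 < Im w})"
    by (intro open_Int open_ball open_halfspace_Im_gt)
  moreover have "ball w r \<inter> {w. 0 < Im w} \<subseteq> ball w r \<inter> half_plane" by auto
  ultimately have "w' \<in> interior (ball w r \<inter> half_plane)"
    using interior_maximal by blast
  then have "interior (ball w r \<inter> half_plane) \<noteq> {}" by blast
  then have "aff_dim (ball w r \<inter> half_plane) = int DIM(complex)"
    by (rule aff_dim_nonempty_interior)
  then have "aff_dim (ball w r \<inter> half_plane) \<noteq> 1" by simp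
  moreover have "convex (ball w r \<inter> half_plane)"
    by (intro convex_Int convex_ball convex_halfspace_Im_ge)
  ultimately show "connected (ball w r \<inter> half_plane - {w})"
    by (intro connected_punctured_convex)
  have "w' \<noteq> w" using assms(2) by (auto simp: w'_def complex_eq_iff)
  then show "\<exists>w'. w' \<in> ball w r \<inter> half_plane \<and> w' \<noteq> w"
    using \<open>w' \<in> ball w r \<inter> {w. 0 < Im w}\<close> by force
qed

text \<open>The image of a small disc cut with the half-plane also serves at boundary points.
  \<open>N \<noteq> {x}\<close> records that no point is isolated.\<close>

lemma two_manifold_punctured_nhd:
  assumes "two_manifold_with_boundary S" "x \<in> S" "openin (top_of_set S) A" "x \<in> A"
  obtains N where "openin (top_of_set S) N" "x \<in> N" "N \<subseteq> A" "N \<noteq> {x}" "connected (N - {x})"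
proof -
  obtain U W f g where U: "openin (top_of_set S) U" "x \<in> U" "U \<subseteq> A" and
      W: "openin (top_of_set half_plane) W" and fg: "homeomorphism U W f g"
    using two_manifold_chart[OF assms] by blast
  define w where "w = f x"
  have w: "w \<in> W" "g w = x" using fg U(2) by (auto simp: w_def homeomorphism_def)
  then have wh: "w \<in> half_plane" using openin_imp_subset[OF W] by blast
  obtain r where r: "0 < r" "cball w r \<inter> half_plane \<subseteq> W"
    using openin_half_plane_contains_ball[OF W w(1)] by blast
  define B where "B = ball w r \<inter> half_plane"
  have BW: "B \<subseteq> W" using r(2) ball_subset_cball[of w r] by (auto simp: B_def)
  have gf: "homeomorphism W U g f" using fg homeomorphism_symD by blast
  have inj: "inj_on g W" using gf by (metis homeomorphism_def inj_on_inverseI)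
  have "openin (top_of_set half_plane) B"
    unfolding B_def Int_commute[of "ball w r"] by (intro openin_open_Int open_ball)
  then have "openin (top_of_set W) B"
    using BW openin_subset_trans openin_imp_subset[OF W] by blast
  then have "openin (top_of_set U) (g ` B)" by (rule homeomorphism_imp_open_map[OF gf])
  then have 1: "openin (top_of_set S) (g ` B)" using U(1) openin_trans by blast
  have wB: "w \<in> B" using wh r(1) by (simp add: B_def)
  then have 2: "x \<in> g ` B" using w(2) by blast
  have 3: "g ` B \<subseteq> A" using BW gf U(3) by (auto simp: homeomorphism_def)
  have eq: "g ` B - {x} = g ` (B - {w})"
    using inj BW wB w(2) by (auto simp: inj_on_def)
  have "continuous_on (B - {w}) g"
    using gf BW by (meson Diff_subset continuous_on_subset homeomorphism_def)
  moreover have "connected (B - {w})" using half_disc(1)[OF wh r(1)] by (simp add: B_def)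
  ultimately have 4: "connected (g ` B - {x})"
    unfolding eq by (rule connected_continuous_image)
  have "B - {w} \<noteq> {}" using half_disc(2)[OF wh r(1)] by (auto simp: B_def)
  then have 5: "g ` B \<noteq> {x}" using eq by auto
  show ?thesis by (rule that[OF 1 2 3 5 4])
qed

text \<open>Local compactness, from which finiteness of the vertex degrees is derived.\<close>

lemma two_manifold_compact_nhd:
  assumes "two_manifold_with_boundary S" "x \<in> S"
  obtains C N where "compact C" "C \<subseteq> S" "openin (top_of_set S) N" "x \<in> N" "N \<subseteq> C"
proof -
  obtain U W f g where U: "openin (top_of_set S) U" "x \<in> U" and
      W: "openin (top_of_set half_plane) W" and fg: "homeomorphism U W f g"
    using two_manifold_chart[OF assms(1,2) _ assms(2)] openin_subtopology_self
    by (metis (no_types, lifting) openin_subtopology_refl subset_UNIV topspace_euclidean)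
  define w where "w = f x"
  have w: "w \<in> W" "g w = x" using fg U(2) by (auto simp: w_def homeomorphism_def)
  obtain r where r: "0 < r" "cball w r \<inter> half_plane \<subseteq> W"
    using openin_half_plane_contains_ball[OF W w(1)] by blast
  have gf: "homeomorphism W U g f" using fg homeomorphism_symD by blast
  have "closed half_plane" by (rule closed_halfspace_Im_ge)
  then have "compact (cball w r \<inter> half_plane)" by (intro compact_Int_closed compact_cball)
  then have "compact (g ` (cball w r \<inter> half_plane))"
    using gf r(2) by (intro compact_continuous_image) (meson continuous_on_subset homeomorphism_def)
  moreover have "g ` (cball w r \<inter> half_plane) \<subseteq> S"
  proof -
    have "g ` W = U" using gf by (simp add: homeomorphism_def)
    then show ?thesis using r(2) openin_imp_subset[OF U(1)] by blast
  qed
  moreover have "openin (top_of_set S) (g ` (W \<inter> ball w r))"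
  proof -
    have "openin (top_of_set W) (W \<inter> ball w r)" by (intro openin_open_Int open_ball)
    then have "openin (top_of_set U) (g ` (W \<inter> ball w r))" by (rule homeomorphism_imp_open_map[OF gf])
    then show ?thesis using U(1) openin_trans by blast
  qed
  moreover have "x \<in> g ` (W \<inter> ball w r)" using w r(1) by force
  moreover have "g ` (W \<inter> ball w r) \<subseteq> g ` (cball w r \<inter> half_plane)"
    using openin_imp_subset[OF W] by (intro image_mono) auto
  ultimately show ?thesis by (rule that)
qed

text \<open>\<open>P\<close> and \<open>Q\<close> would split a connected punctured neighbourhood of
  \<open>x\<close> into two nonempty open parts. At a vertex this yields a connected link, at the
  midpoint of an edge it yields a face.\<close>

lemma two_manifold_not_separated_by_point:
  assumes "two_manifold_with_boundary S" "x \<in> S" "openin (top_of_set S) A" "x \<in> A"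
    and P: "openin (top_of_set S) P" and Q: "openin (top_of_set S) Q" "P \<inter> Q = {}" "A - {x} \<subseteq> P \<union> Q"
    and "\<And>N. openin (top_of_set S) N \<Longrightarrow> x \<in> N \<Longrightarrow> N \<inter> (P - {x}) \<noteq> {}"
    and "\<And>N. openin (top_of_set S) N \<Longrightarrow> x \<in> N \<Longrightarrow> N \<inter> (Q - {x}) \<noteq> {}"
  shows False
proof -
  obtain N where N: "openin (top_of_set S) N" "x \<in> N" "N \<subseteq> A" "connected (N - {x})"
    using two_manifold_punctured_nhd[OF assms(1-4)] by blast
  obtain P' where P': "open P'" "P = S \<inter> P'" using P unfolding openin_open by blast
  obtain Q' where Q': "open Q'" "Q = S \<inter> Q'" using Q(1) unfolding openin_open by blast
  have NS: "N \<subseteq> S" using N(1) openin_imp_subset by blast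
  have "N \<inter> (P - {x}) \<subseteq> P' \<inter> (N - {x})" "N \<inter> (Q - {x}) \<subseteq> Q' \<inter> (N - {x})"
    using P'(2) Q'(2) by auto
  then have "P' \<inter> (N - {x}) \<noteq> {}" "Q' \<inter> (N - {x}) \<noteq> {}"
    using assms(9)[OF N(1,2)] assms(10)[OF N(1,2)] by auto
  moreover have "P' \<inter> Q' \<inter> (N - {x}) \<subseteq> P \<inter> Q" using NS P'(2) Q'(2) by auto
  then have "P' \<inter> Q' \<inter> (N - {x}) = {}" using Q(2) by simp
  moreover have "P \<union> Q \<subseteq> P' \<union> Q'" using P'(2) Q'(2) by auto
  then have "N - {x} \<subseteq> P' \<union> Q'" using N(3) Q(3) by auto
  ultimately show False using connectedD[OF N(4) P'(1) Q'(1)] by blast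
qed

text \<open>Composed with an inverse chart, \<open>f\<close> is continuous and injective on an open
  set of the plane, so by invariance of domain its image is open and avoids the boundary line.
  Admitting any such \<open>f\<close> allows barycentric coordinates of an edge star as well as
  charts.\<close>

lemma manifold_interior_Im_pos:
  assumes "x \<in> manifold_interior S" "openin (top_of_set S) U" "x \<in> U"
    and f: "continuous_on U f" "inj_on f U" "f ` U \<subseteq> half_plane"
  shows "0 < Im (f x)"
proof -
  obtain V and W :: "complex set" where V: "openin (top_of_set S) V" "x \<in> V" and W: "open W"
      and "V homeomorphic W"
    using assms(1) unfolding manifold_interior_def by blast
  then obtain h g where hg: "homeomorphism V W h g" unfolding homeomorphic_def by blast
  have gh: "homeomorphism W V g h" using hg homeomorphism_symD by blast
  have "openin (top_of_set V) (V \<inter> U)"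
    using assms(2) V(1) openin_subset_trans[of S "V \<inter> U" V] openin_imp_subset by blast
  then have "openin (top_of_set W) (h ` (V \<inter> U))" by (rule homeomorphism_imp_open_map[OF hg])
  then have O: "open (h ` (V \<inter> U))" using W openin_open_trans by blast
  have gO: "g ` h ` (V \<inter> U) = V \<inter> U" using hg by (force simp: homeomorphism_def)
  have hW: "h ` (V \<inter> U) \<subseteq> W" using hg by (auto simp: homeomorphism_def)
  have "continuous_on (h ` (V \<inter> U)) (f \<circ> g)"
  proof (rule continuous_on_compose)
    show "continuous_on (h ` (V \<inter> U)) g" using gh hW continuous_on_subset by (auto simp: homeomorphism_def)
    show "continuous_on (g ` h ` (V \<inter> U)) f" unfolding gO using f(1) continuous_on_subset by blast
  qed
  moreover have "inj_on (f \<circ> g) (h ` (V \<inter> U))"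
  proof (rule comp_inj_on)
    show "inj_on g (h ` (V \<inter> U))" using gh hW
      by (metis homeomorphism_def inj_on_inverseI inj_on_subset)
    show "inj_on f (g ` h ` (V \<inter> U))" unfolding gO using f(2) inj_on_subset by blast
  qed
  ultimately have "open ((f \<circ> g) ` h ` (V \<inter> U))" using invariance_of_domain[OF _ O] by blast
  then have op: "open (f ` (V \<inter> U))" by (simp only: image_comp[symmetric] gO)
  have "f ` (V \<inter> U) \<subseteq> half_plane" using f(3) by blast
  then have "f ` (V \<inter> U) \<subseteq> interior half_plane" using op by (rule interior_maximal)
  moreover have "interior half_plane = {w. 0 < Im w}"
    using interior_halfspace_ge[of \<i> 0] by (simp add: inner_complex_def)
  ultimately show ?thesis using V(2) assms(3) by blast
qed

lemma openin_manifold_interior: "openin (top_of_set S) (manifold_interior S)"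
proof (subst openin_subopen, intro ballI)
  fix x
  assume "x \<in> manifold_interior S"
  then obtain V and W :: "complex set" where V: "openin (top_of_set S) V" "x \<in> V" "open W" "V homeomorphic W"
    unfolding manifold_interior_def by blast
  then have "V \<subseteq> manifold_interior S"
    using openin_imp_subset unfolding manifold_interior_def by blast
  then show "\<exists>T. openin (top_of_set S) T \<and> x \<in> T \<and> T \<subseteq> manifold_interior S" using V by blast
qed

text \<open>The points of the boundary line of a half-plane chart at a boundary point \<open>x\<close> are boundary
  points by invariance of domain, hence \<open>x\<close> is not isolated in the boundary.\<close>

lemma manifold_interior_isolated_point:
  assumes "two_manifold_with_boundary S" "x \<in> S" "openin (top_of_set S) A" "x \<in> A"
    and int: "A - {x} \<subseteq> manifold_interior S"
  shows "x \<in> manifold_interior S"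
proof (rule ccontr)
  assume x: "x \<notin> manifold_interior S"
  obtain U W f g where U: "openin (top_of_set S) U" "x \<in> U" "U \<subseteq> A" and
      W: "openin (top_of_set half_plane) W" and fg: "homeomorphism U W f g"
    using two_manifold_chart[OF assms(1-4)] by blast
  have fh: "f ` U \<subseteq> half_plane" using fg openin_imp_subset[OF W] by (auto simp: homeomorphism_def)
  have inj: "inj_on f U" using fg by (metis homeomorphism_def inj_on_inverseI)
  have cf: "continuous_on U f" using fg by (simp add: homeomorphism_def)
  have gf: "homeomorphism W U g f" using fg homeomorphism_symD by blast
  have fx: "f x \<in> W" using fg U(2) by (auto simp: homeomorphism_def)
  \<comment> \<open>Otherwise the part of the chart above the boundary line would give a Euclidean
    neighbourhood of \<open>x\<close>.\<close>
  have "Im (f x) = 0"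
  proof (rule ccontr)
    assume "Im (f x) \<noteq> 0"
    then have pos: "0 < Im (f x)" using fh U(2) by force
    obtain W' where W': "open W'" "W = half_plane \<inter> W'" using W unfolding openin_open by blast
    define W0 where "W0 = W' \<inter> {w. 0 < Im w}"
    have "open W0" unfolding W0_def using W'(1) by (intro open_Int open_halfspace_Im_gt)
    moreover have W0W: "W0 \<subseteq> W" using W'(2) by (auto simp: W0_def)
    moreover have "openin (top_of_set W) W0"
      using calculation by (simp add: open_subset)
    then have "openin (top_of_set U) (g ` W0)" by (rule homeomorphism_imp_open_map[OF gf])
    then have "openin (top_of_set S) (g ` W0)" using U(1) openin_trans by blast
    moreover have "homeomorphism W0 (g ` W0) g f"
      by (rule homeomorphism_of_subsets[OF gf W0W]) auto
    then have "g ` W0 homeomorphic W0" using homeomorphic_def homeomorphic_sym by blast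
    moreover have "f x \<in> W0" using pos fx W'(2) by (auto simp: W0_def)
    then have "x \<in> g ` W0" using fg U(2) by (force simp: homeomorphism_def)
    ultimately have "x \<in> manifold_interior S"
      using assms(2) unfolding manifold_interior_def by blast
    then show False using x by blast
  qed
  obtain r where r: "0 < r" "cball (f x) r \<inter> half_plane \<subseteq> W"
    using openin_half_plane_contains_ball[OF W fx] by blast
  define w where "w = f x + of_real r"
  have "w \<in> W" using r \<open>Im (f x) = 0\<close> by (auto simp: w_def dist_norm)
  then have y: "g w \<in> U" "f (g w) = w" using fg by (auto simp: homeomorphism_def)
  have "g w \<noteq> x" using y(2) r(1) by (auto simp: w_def)
  then have "g w \<in> manifold_interior S" using y(1) U(3) int by blast
  then have "0 < Im (f (g w))" using manifold_interior_Im_pos[OF _ U(1) y(1) cf inj fh] by blast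
  then show False using y(2) \<open>Im (f x) = 0\<close> by (simp add: w_def)
qed

section \<open>The local structure of a mesh\<close>

locale mesh =
  fixes K :: "'v set set" and T :: "('v \<times> 'v \<times> 'v) set"
  assumes mesh: "triangular_mesh K T"
begin

sublocale simplicial_complex K
  using mesh by unfold_locales (simp add: triangular_mesh_def)

lemma manifold: "two_manifold_with_boundary X"
  and connected: "connected X"
  and card_simplex: "s \<in> K \<Longrightarrow> card s \<le> 3"
  using mesh unfolding triangular_mesh_def by auto

lemma orientation: "mesh_orientation K T"
  using mesh unfolding triangular_mesh_def by blast

lemma triangle: "(i, j, k) \<in> T \<Longrightarrow> {i, j, k} \<in> K"
  and triangle_distinct: "(i, j, k) \<in> T \<Longrightarrow> i \<noteq> j \<and> j \<noteq> k \<and> i \<noteq> k"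
  and rotate: "(i, j, k) \<in> T \<Longrightarrow> (j, k, i) \<in> T"
  and oriented: "{i, j, k} \<in> K \<Longrightarrow> distinct [i, j, k] \<Longrightarrow> (i, j, k) \<in> T \<or> (j, i, k) \<in> T"
  and left_unique: "(i, j, k) \<in> T \<Longrightarrow> (i, j, l) \<in> T \<Longrightarrow> k = l"
  using conjunct1[OF orientation[unfolded mesh_orientation_def], rule_format, of i j k]
    conjunct1[OF conjunct2[OF orientation[unfolded mesh_orientation_def]], rule_format, of i j k]
    conjunct1[OF conjunct2[OF conjunct2[OF orientation[unfolded mesh_orientation_def]]], rule_format, of i j k]
    conjunct2[OF conjunct2[OF conjunct2[OF orientation[unfolded mesh_orientation_def]]], rule_format, of i j k l]
  by auto

lemma left_vertex: "(i, j, k) \<in> T \<Longrightarrow> left_vertex T i j = k"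
  unfolding left_vertex_def using left_unique by blast

lemma edge_of_triangle:
  assumes "(i, j, k) \<in> T"
  shows "{i, j} \<in> K"
  by (rule face[OF triangle[OF assms]]) auto

lemma neighbours_sym: "j \<in> neighbours K i \<longleftrightarrow> i \<in> neighbours K j"
  by (auto simp: neighbours_def insert_commute)

lemma vertex_of_edge: "{i, j} \<in> K \<Longrightarrow> {i} \<in> K"
  by (erule face) auto

lemma triangle_neighbours:
  assumes "(i, j, k) \<in> T"
  shows "j \<in> neighbours K i" "k \<in> neighbours K i"
  using edge_of_triangle[OF assms] edge_of_triangle[OF rotate[OF rotate[OF assms]]] triangle_distinct[OF assms]
  by (auto simp: neighbours_def insert_commute)

lemma carrier_superset:
  assumes "x \<in> X" "a \<in> carrier x" "b \<in> carrier x" "a \<noteq> b"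
  obtains "carrier x = {a, b}" | c where "carrier x = {a, b, c}" "c \<noteq> a" "c \<noteq> b"
proof (cases "carrier x = {a, b}")
  case False
  note K = carrier_simplex[OF assms(1)]
  obtain c where c: "c \<in> carrier x" "c \<noteq> a" "c \<noteq> b" using False assms(2,3) by blast
  have "{a, b, c} \<subseteq> carrier x" using c assms by auto
  moreover have "card {a, b, c} = 3" using c assms(4) by auto
  ultimately have "carrier x = {a, b, c}"
    using card_simplex[OF K] finite_simplex[OF K] by (metis card_seteq)
  then show ?thesis using that c by blast
qed

text \<open>A basic open set inside a compact neighbourhood of the vertex restricts only finitely
  many coordinates, so the neighbourhood contains \<open>edge_point v j t\<close>, with one common
  \<open>t\<close>, for all but finitely many neighbours \<open>j\<close>. An open cover separating
  these points bounds their number.\<close>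

lemma finite_neighbours:
  assumes "{v} \<in> K"
  shows "finite (neighbours K v)"
proof -
  have vX: "vertex_point v \<in> X" using vertex_point_in[OF assms] .
  obtain C N where C: "compact C" "C \<subseteq> X" and N: "openin (top_of_set X) N" "vertex_point v \<in> N" "N \<subseteq> C"
    using two_manifold_compact_nhd[OF manifold vX] by blast
  obtain G where G: "open G" "N = X \<inter> G" using N(1) unfolding openin_open by blast
  have "openin (product_topology (\<lambda>i. euclidean) UNIV) G" using G(1) by (simp add: open_fun_def)
  then obtain B where B: "vertex_point v \<in> (\<Pi>\<^sub>E i\<in>UNIV. B i)" "\<And>i. open (B i :: real set)"
      "finite {i. B i \<noteq> UNIV}" "(\<Pi>\<^sub>E i\<in>UNIV. B i) \<subseteq> G"
    using product_topology_open_contains_basis[of "\<lambda>i. euclidean :: real topology" UNIV G "vertex_point v"]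
      N(2) G(2) by auto
  have "vertex_point v v \<in> B v" using B(1) by (simp add: PiE_iff)
  then have "1 \<in> B v" by (simp add: vertex_point_def)
  then obtain e where e: "e > 0" "ball 1 e \<subseteq> B v" using B(2) open_contains_ball by blast
  define t where "t = min (e/2) (1/2)"
  have t: "0 < t" "t < 1" "1 - t \<in> B v"
    using e by (auto simp: t_def dist_real_def subset_iff min_def)
  define J where "J = neighbours K v - {i. B i \<noteq> UNIV}"
  have J: "edge_point v j t \<in> C" if "j \<in> J" for j
  proof -
    have j: "{v, j} \<in> K" "v \<noteq> j" "B j = UNIV" using that by (auto simp: J_def neighbours_def)
    have "edge_point v j t i \<in> B i" for i
    proof -
      have "vertex_point v i \<in> B i" using B(1) by (simp add: PiE_iff)
      then show ?thesis using j(3) t(3) by (auto simp: edge_point_def vertex_point_def)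
    qed
    then have "edge_point v j t \<in> G" using B(4) by (auto simp: PiE_iff)
    moreover have "edge_point v j t \<in> X" using edge_point_in[OF j(1,2)] t by simp
    ultimately show ?thesis using G(2) N(3) by blast
  qed
  \<comment> \<open>\<open>Oc v\<close> misses every \<open>edge_point v j t\<close>, whose
    coordinate at \<open>v\<close> is exactly \<open>1 - t\<close>; for \<open>k \<noteq> v\<close>
    the set \<open>Oc k\<close> contains only the one with \<open>j = k\<close>.\<close>
  define Oc where "Oc k = (if k = v then {x :: 'v \<Rightarrow> real. 1 - t < x v} else {x. 0 < x k})" for k
  have "open (Oc k)" for k
    unfolding Oc_def by (auto intro!: open_Collect_less continuous_intros)
  moreover have "C \<subseteq> (\<Union>k\<in>UNIV. Oc k)"
  proof
    fix x
    assume "x \<in> C"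
    then have x: "x \<in> X" using C(2) by blast
    show "x \<in> (\<Union>k\<in>UNIV. Oc k)"
    proof (cases "carrier x \<subseteq> {v}")
      case True
      then have "x v = 1" using vertex_point_unique[OF x True] by (simp add: vertex_point_def)
      then have "x \<in> Oc v" using t(1) by (simp add: Oc_def)
      then show ?thesis by blast
    next
      case False
      then obtain k where "k \<in> carrier x" "k \<noteq> v" by blast
      then have "x \<in> Oc k" using x by (simp add: Oc_def mem_carrier)
      then show ?thesis by blast
    qed
  qed
  ultimately obtain D where D: "finite D" "C \<subseteq> (\<Union>k\<in>D. Oc k)"
    using compactE_image[OF C(1), of UNIV Oc] by auto
  have "J \<subseteq> D"
  proof
    fix j
    assume j: "j \<in> J"
    then obtain k where k: "k \<in> D" "edge_point v j t \<in> Oc k" using J D(2) by blast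
    then have "k = j" by (auto simp: Oc_def edge_point_def split: if_splits)
    then show "j \<in> D" using k by simp
  qed
  then have "finite J" using D(1) finite_subset by blast
  then show ?thesis unfolding J_def using B(3) by simp
qed

text \<open>A proper part of the link closed under adjacency would separate the star of
  \<open>v\<close> at \<open>v\<close>. This serves as an induction principle around a vertex, for
  cyclic links and arcs alike.\<close>

lemma link_connected:
  assumes "{v} \<in> K" "S \<subseteq> neighbours K v" "S \<noteq> {}"
    and closed: "\<And>j k. {v, j, k} \<in> K \<Longrightarrow> distinct [v, j, k] \<Longrightarrow> j \<in> S \<Longrightarrow> k \<in> S"
  shows "S = neighbours K v"
proof (rule ccontr)
  assume "S \<noteq> neighbours K v"
  define part where "part R = (\<Union>j\<in>R. open_star K v \<inter> open_star K j)" for R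
  have op: "openin (top_of_set X) (part R)" for R
    unfolding part_def by (intro openin_Union) (auto intro: openin_Int open_star_open)
  have near: "N \<inter> (part R - {vertex_point v}) \<noteq> {}"
    if N: "openin (top_of_set X) N" "vertex_point v \<in> N" and j: "j \<in> R" "j \<in> neighbours K v" for N R j
  proof -
    have e: "{v, j} \<in> K" "v \<noteq> j" using j by (auto simp: neighbours_def)
    obtain s where s: "0 < s" "s < 1" "edge_point v j s \<in> N"
      using edge_point_near[OF e, of 0 N] N by (auto simp: edge_point_0[OF e(2)])
    have "edge_point v j s \<in> part R"
      using e s j(1) edge_point_in[OF e, of s] by (auto simp: part_def open_star_def) (auto simp: edge_point_def)
    moreover have "edge_point v j s j \<noteq> vertex_point v j" using e s by (auto simp: edge_point_def vertex_point_def)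
    ultimately show ?thesis using s(3) by auto
  qed
  let ?Q = "neighbours K v - S"
  show False
  proof (rule two_manifold_not_separated_by_point[OF manifold vertex_point_in[OF assms(1)] open_star_open[of v]])
    show "vertex_point v \<in> open_star K v"
      using vertex_point_in[OF assms(1)] by (simp add: open_star_def) (simp add: vertex_point_def)
    show "part S \<inter> part ?Q = {}"
    proof (rule ccontr)
      assume "part S \<inter> part ?Q \<noteq> {}"
      then obtain x j k where "x \<in> X" "v \<in> carrier x" "j \<in> carrier x" "k \<in> carrier x" "j \<in> S" "k \<in> ?Q"
        by (auto simp: part_def open_star_def mem_carrier)
      then have "{v, j, k} \<in> K" "j \<in> S" "k \<in> ?Q" using face[OF carrier_simplex[of x], of "{v, j, k}"] by auto
      moreover have "distinct [v, j, k]" using calculation assms(2) by (auto simp: neighbours_def)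
      ultimately show False using closed by blast
    qed
    show "open_star K v - {vertex_point v} \<subseteq> part S \<union> part ?Q"
    proof
      fix x
      assume x: "x \<in> open_star K v - {vertex_point v}"
      then have xX: "x \<in> X" and v: "v \<in> carrier x" by (auto simp: open_star_def mem_carrier)
      then obtain j where j: "j \<in> carrier x" "j \<noteq> v" using vertex_point_unique[OF xX, of v] x by blast
      then have "{v, j} \<in> K" using face[OF carrier_simplex[OF xX], of "{v, j}"] v by auto
      then have "j \<in> neighbours K v" using j by (simp add: neighbours_def)
      moreover have "x \<in> open_star K v \<inter> open_star K j"
        using xX v j by (simp add: open_star_def mem_carrier)
      ultimately show "x \<in> part S \<union> part ?Q" by (auto simp: part_def)
    qed
  qed (use op near assms(2,3) \<open>S \<noteq> neighbours K v\<close> in blast)+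
qed

text \<open>Without neighbours the open star would be an isolated point.\<close>

lemma vertex_has_neighbour:
  assumes "{v} \<in> K"
  shows "neighbours K v \<noteq> {}"
proof
  assume n: "neighbours K v = {}"
  have v: "vertex_point v \<in> X" using vertex_point_in[OF assms] .
  moreover have "vertex_point v \<in> open_star K v"
    using v by (simp add: open_star_def) (simp add: vertex_point_def)
  ultimately obtain N where N: "vertex_point v \<in> N" "N \<subseteq> open_star K v" "N \<noteq> {vertex_point v}"
    using two_manifold_punctured_nhd[OF manifold _ open_star_open] by metis
  then obtain x where x: "x \<in> open_star K v" "x \<noteq> vertex_point v" by blast
  then have xX: "x \<in> X" and vx: "v \<in> carrier x" by (auto simp: open_star_def mem_carrier)
  then obtain j where j: "j \<in> carrier x" "j \<noteq> v" using vertex_point_unique[OF xX, of v] x by blast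
  then have "{v, j} \<in> K" using face[OF carrier_simplex[OF xX], of "{v, j}"] vx by auto
  then show False using n j by (auto simp: neighbours_def)
qed

text \<open>The open star of an edge without faces is an open segment, which its midpoint
  disconnects.\<close>

lemma edge_has_triangle:
  assumes "j \<in> neighbours K i"
  obtains k where "(i, j, k) \<in> T \<or> (j, i, k) \<in> T"
proof (rule ccontr)
  assume no: "\<not> thesis"
  have e: "{i, j} \<in> K" "i \<noteq> j" using assms by (auto simp: neighbours_def)
  define A where "A = open_star K i \<inter> open_star K j"
  have A: "x i + x j = 1" "x \<in> X" if "x \<in> A" for x
  proof -
    have x: "x \<in> X" "i \<in> carrier x" "j \<in> carrier x" using that by (auto simp: A_def open_star_def mem_carrier)
    have "carrier x = {i, j}"
      using x(1,2,3) e(2)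
    proof (cases rule: carrier_superset)
      case (2 c)
      then have "{i, j, c} \<in> K" "distinct [i, j, c]" using carrier_simplex[OF x(1)] e(2) by auto
      then have "(i, j, c) \<in> T \<or> (j, i, c) \<in> T" using oriented by blast
      then show ?thesis using no \<open>\<And>k. (i, j, k) \<in> T \<or> (j, i, k) \<in> T \<Longrightarrow> thesis\<close> by blast
    qed
    then show "x i + x j = 1" "x \<in> X" using sum_carrier[OF x(1)] e(2) x(1) by auto
  qed
  define m where "m = edge_point i j (1/2)"
  define P where "P = A \<inter> {x \<in> X. 0 < x i - x j}"
  define Q where "Q = A \<inter> {x \<in> X. 0 < x j - x i}"
  have op: "openin (top_of_set X) A" "openin (top_of_set X) P" "openin (top_of_set X) Q"
    unfolding P_def Q_def A_def by (intro openin_Int open_star_open openin_superlevel continuous_intros)+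
  have mA: "m \<in> A" and mX: "m \<in> X"
    using edge_point_in[OF e, of "1/2"] e by (auto simp: A_def m_def open_star_def) (auto simp: edge_point_def)
  \<comment> \<open>\<open>edge_point_near\<close> moves towards the second end only, so the side of
    \<open>i\<close> is reached by reversing the edge.\<close>
  have flip: "edge_point j i (1 - s) = edge_point i j s" for s
    using e(2) by (auto simp: edge_point_def)
  have in_star: "edge_point i j s \<in> A \<inter> X" if "0 < s" "s < 1" for s
    using edge_point_in[OF e, of s] that e by (auto simp: A_def open_star_def) (auto simp: edge_point_def)
  have near: "N \<inter> (P - {m}) \<noteq> {}" "N \<inter> (Q - {m}) \<noteq> {}"
    if N: "openin (top_of_set X) N" "m \<in> N" for N
  proof -
    obtain s where s: "1/2 < s" "s < 1" "edge_point i j s \<in> N"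
      using edge_point_near[OF e, of "1/2" N] N by (auto simp: m_def)
    have "edge_point i j s \<in> Q - {m}"
      using in_star[of s] s e(2) by (auto simp: Q_def m_def edge_point_def fun_eq_iff)
    then show "N \<inter> (Q - {m}) \<noteq> {}" using s(3) by blast
    have e': "{j, i} \<in> K" "j \<noteq> i" using e by (auto simp: insert_commute)
    have "edge_point j i (1/2) \<in> N" using N(2) flip[of "1/2"] by (simp add: m_def)
    then obtain t where t: "1/2 < t" "t < 1" "edge_point j i t \<in> N"
      using edge_point_near[OF e', of "1/2" N] N by auto
    have "edge_point i j (1 - t) \<in> P - {m}"
      using in_star[of "1 - t"] t e(2) by (auto simp: P_def m_def edge_point_def fun_eq_iff)
    moreover have "edge_point i j (1 - t) \<in> N" using t(3) flip[of "1 - t"] by simp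
    ultimately show "N \<inter> (P - {m}) \<noteq> {}" by blast
  qed
  have "A - {m} \<subseteq> P \<union> Q"
  proof
    fix x
    assume x: "x \<in> A - {m}"
    have "x i \<noteq> x j"
    proof
      assume "x i = x j"
      then have h: "x i = 1/2" "x j = 1/2" using A[of x] x by auto
      have "sum x {i, j} = 1" using h e(2) by simp
      moreover have xX: "x \<in> X" using A(2) x by blast
      have "x u = 0" if "u \<noteq> i" "u \<noteq> j" for u
      proof (rule ccontr)
        assume u: "x u \<noteq> 0"
        have "sum x {i, j, u} \<le> sum x (carrier x)"
          using u h nonneg[OF xX] finite_simplex[OF carrier_simplex[OF xX]]
          by (intro sum_mono2) (auto simp: carrier_def)
        then have "x u \<le> 0" using sum_carrier[OF xX] h e(2) that by simp
        then show False using u nonneg[OF xX, of u] by simp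
      qed
      then have "x = m" using h by (auto simp: m_def edge_point_def fun_eq_iff)
      then show False using x by blast
    qed
    then show "x \<in> P \<union> Q" using x A(2) by (auto simp: P_def Q_def)
  qed
  moreover have "P \<inter> Q = {}" by (auto simp: P_def Q_def)
  ultimately show False
    using two_manifold_not_separated_by_point[OF manifold mX op(1) mA op(2,3)] near by blast
qed

end

section \<open>Interior edges and vertices in terms of faces\<close>

context mesh
begin

definition two_faced :: "'v \<Rightarrow> 'v \<Rightarrow> bool" where
  "two_faced i j \<longleftrightarrow> (\<exists>k. (i, j, k) \<in> T) \<and> (\<exists>k. (j, i, k) \<in> T)"

lemma two_faced_sym: "two_faced i j \<longleftrightarrow> two_faced j i"
  by (auto simp: two_faced_def)

lemma two_faced_neighbour: "two_faced i j \<Longrightarrow> j \<in> neighbours K i"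
  using triangle_neighbours unfolding two_faced_def by blast

lemma orientation_exclusive: "(i, j, k) \<in> T \<Longrightarrow> (j, i, k) \<notin> T"
  using orientation triangle[of i j k] triangle_distinct[of i j k]
  unfolding mesh_orientation_def by (metis (no_types, lifting) distinct_length_2_or_more distinct_singleton)

lemma carrier_edge_star:
  assumes "x \<in> X" "i \<in> carrier x" "j \<in> carrier x" "i \<noteq> j"
  obtains "carrier x = {i, j}"
    | c where "carrier x = {i, j, c}" "c \<noteq> i" "c \<noteq> j" "(i, j, c) \<in> T \<or> (j, i, c) \<in> T"
  using assms
proof (cases rule: carrier_superset)
  case (2 c)
  then show ?thesis using that(2) oriented[of i j c] carrier_simplex[OF assms(1)] assms(4) by auto
qed (use that in blast)

text \<open>The open star of an edge with two faces is an open diamond.\<close>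

lemma two_faced_interior:
  assumes "two_faced i j" "x \<in> open_star K i \<inter> open_star K j"
  shows "x \<in> manifold_interior X"
proof -
  obtain c d where c: "(i, j, c) \<in> T" and d: "(j, i, d) \<in> T"
    using assms(1) unfolding two_faced_def by blast
  have ne: "i \<noteq> j" "c \<noteq> i" "c \<noteq> j" "d \<noteq> i" "d \<noteq> j" "c \<noteq> d"
    using triangle_distinct[OF c] triangle_distinct[OF d] orientation_exclusive[OF c] d by auto
  define U where "U = open_star K i \<inter> open_star K j"
  define W where "W = {w::complex. \<bar>Re w\<bar> + \<bar>Im w\<bar> < 1}"
  \<comment> \<open>At most one of the coordinates at \<open>c\<close> and \<open>d\<close> is
    nonzero, so the imaginary part determines both and its modulus is their sum; total mass 1 then
    recovers the coordinates at \<open>i\<close> and \<open>j\<close>, which gives \<open>g\<close>.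
    Their positivity is the inequality in \<open>W\<close>.\<close>
  define f where "f y = Complex (y i - y j) (y c - y d)" for y :: "'v \<Rightarrow> real"
  define g where "g w = (\<lambda>u. if u = i then (1 - \<bar>Im w\<bar> + Re w) / 2 else if u = j then (1 - \<bar>Im w\<bar> - Re w) / 2
    else if u = c then max (Im w) 0 else if u = d then max (- Im w) 0 else 0)" for w
  have U: "y \<in> X \<and> 0 < y i \<and> 0 < y j \<and> 0 \<le> y c \<and> 0 \<le> y d \<and> y i + y j + y c + y d = 1 \<and> (y c = 0 \<or> y d = 0)
      \<and> (\<forall>u. u \<notin> {i, j, c, d} \<longrightarrow> y u = 0)" if "y \<in> U" for y
  proof -
    have y: "y \<in> X" "i \<in> carrier y" "j \<in> carrier y" and pos: "0 < y i" "0 < y j"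
      using that by (auto simp: U_def open_star_def mem_carrier)
    have F: "carrier y \<subseteq> {i, j, c, d} \<and> \<not> {c, d} \<subseteq> carrier y"
      using y ne(1)
    proof (cases rule: carrier_edge_star)
      case 1
      then show ?thesis using ne by auto
    next
      case (2 e)
      then have "e = c \<or> e = d" using left_unique c d by blast
      then show ?thesis using 2 ne by auto
    qed
    then have "sum y {i, j, c, d} = 1" using sum_coordinates[OF y(1)] by simp
    then have "y i + y j + y c + y d = 1" using ne by simp
    then show ?thesis using F nonneg[OF y(1)] pos y(1) by (auto simp: carrier_def)
  qed
  have g: "g w \<in> U" "f (g w) = w" if "w \<in> W" for w
  proof -
    have pos: "0 < g w i" "0 < g w j" using that ne by (auto simp: g_def W_def)
    have "g w \<in> X"
    proof (cases "0 \<le> Im w")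
      case True
      show ?thesis
      proof (rule underlying_spaceI[of _ "{i, j, c}"])
        show "0 \<le> g w u" for u using that by (auto simp: g_def W_def)
      qed (use True ne triangle[OF c] in \<open>auto simp: g_def carrier_def field_simps\<close>)
    next
      case False
      show ?thesis
      proof (rule underlying_spaceI[of _ "{j, i, d}"])
        show "0 \<le> g w u" for u using that by (auto simp: g_def W_def)
      qed (use False ne triangle[OF d] in \<open>auto simp: g_def carrier_def field_simps\<close>)
    qed
    then show "g w \<in> U" using pos by (simp add: U_def open_star_def)
    show "f (g w) = w" using ne by (auto simp: f_def g_def complex_eq_iff max_def field_simps)
  qed
  have f: "f y \<in> W" "g (f y) = y" if "y \<in> U" for y
  proof -
    note y = U[OF that]
    show "f y \<in> W" using y by (auto simp: f_def W_def)
    show "g (f y) = y"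
    proof
      fix u
      have "\<bar>y c - y d\<bar> = y c + y d" using y by auto
      then show "g (f y) u = y u" using y ne by (auto simp: f_def g_def max_def field_simps)
    qed
  qed
  have "continuous_on U f"
    unfolding f_def by (intro continuous_on_Complex continuous_intros)
  moreover have "continuous_on W g"
  proof (rule continuous_on_coordinatewise_then_product)
    fix u
    show "continuous_on W (\<lambda>w. g w u)"
      unfolding g_def by (cases "u = i"; cases "u = j"; cases "u = c"; cases "u = d") (auto intro!: continuous_intros)
  qed
  ultimately have "homeomorphism U W f g"
    using f g by (intro homeomorphismI) auto
  then have "U homeomorphic W" unfolding homeomorphic_def by blast
  moreover have "open W"
    unfolding W_def by (intro open_Collect_less continuous_intros)
  moreover have "openin (top_of_set X) U"
    unfolding U_def by (intro openin_Int open_star_open)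
  moreover have "x \<in> X" "x \<in> U" using assms(2) U by (auto simp: U_def)
  ultimately show ?thesis unfolding manifold_interior_def by blast
qed

text \<open>With only one face, barycentric coordinates embed the open star of the edge into the
  half-plane with the edge on the boundary line, where no interior point can go.\<close>

lemma interior_edge_point_two_faced:
  assumes j: "j \<in> neighbours K i" and x: "x \<in> manifold_interior X" "carrier x = {i, j}"
  shows "two_faced i j"
proof (rule ccontr)
  assume no: "\<not> two_faced i j"
  obtain c where c: "(i, j, c) \<in> T \<or> (j, i, c) \<in> T" using edge_has_triangle[OF j] by blast
  have unique: "e = c" if "(i, j, e) \<in> T \<or> (j, i, e) \<in> T" for e
    using that c no left_unique unfolding two_faced_def by blast
  have ne: "i \<noteq> j" "c \<noteq> i" "c \<noteq> j" using c triangle_distinct by blast+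
  define U where "U = open_star K i \<inter> open_star K j"
  define f where "f y = Complex (y i - y j) (y c)" for y :: "'v \<Rightarrow> real"
  have U: "y \<in> X \<and> 0 \<le> y c \<and> y i + y j + y c = 1 \<and> (\<forall>u. u \<notin> {i, j, c} \<longrightarrow> y u = 0)" if "y \<in> U" for y
  proof -
    have y: "y \<in> X" "i \<in> carrier y" "j \<in> carrier y"
      using that by (auto simp: U_def open_star_def mem_carrier)
    have F: "carrier y \<subseteq> {i, j, c}"
      using y ne(1) by (cases rule: carrier_edge_star) (use unique in auto)
    then have "sum y {i, j, c} = 1" using sum_coordinates[OF y(1)] by simp
    then have "y i + y j + y c = 1" using ne by simp
    then show ?thesis using F nonneg[OF y(1)] y(1) by (auto simp: carrier_def)
  qed
  have "inj_on f U"
  proof (rule inj_onI, rule ext)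
    fix y y' u
    assume y: "y \<in> U" "y' \<in> U" "f y = f y'"
    have "y i - y j = y' i - y' j" "y c = y' c" using y(3) by (simp_all add: f_def)
    moreover have "y i + y j + y c = 1" "y' i + y' j + y' c = 1" using U y by blast+
    ultimately have "y i = y' i" "y j = y' j" "y c = y' c" by linarith+
    moreover have "y u = y' u" if "u \<notin> {i, j, c}" using U[OF y(1)] U[OF y(2)] that by simp
    ultimately show "y u = y' u" by (cases "u \<in> {i, j, c}") auto
  qed
  moreover have "continuous_on U f"
    unfolding f_def by (intro continuous_on_Complex continuous_intros)
  moreover have "f ` U \<subseteq> half_plane" using U by (auto simp: f_def)
  moreover have "openin (top_of_set X) U"
    unfolding U_def by (intro openin_Int open_star_open)
  moreover have "x \<in> X" using x(1) by (simp add: manifold_interior_def)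
  then have "x \<in> U" using x(2) mem_carrier[of x] by (auto simp: U_def open_star_def)
  ultimately have "0 < Im (f x)" using manifold_interior_Im_pos[OF x(1)] by blast
  moreover have "x c = 0" using x(2) ne unfolding carrier_def by blast
  ultimately show False by (simp add: f_def)
qed

text \<open>The interior is open, so if it contains a vertex point it contains relative interior
  points of every edge at that vertex.\<close>

lemma interior_point_two_faced:
  assumes j: "j \<in> neighbours K i" and x: "x \<in> manifold_interior X" "carrier x \<subseteq> {i, j}"
  shows "two_faced i j"
proof -
  have xX: "x \<in> X" using x(1) by (simp add: manifold_interior_def)
  have vertex: "two_faced a b" if ab: "b \<in> neighbours K a" and c: "carrier x = {a}" for a b
  proof -
    have e: "{a, b} \<in> K" "a \<noteq> b" using ab by (auto simp: neighbours_def)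
    have "edge_point a b 0 \<in> manifold_interior X"
      using vertex_point_unique[OF xX, of a] c x(1) by (simp add: edge_point_0[OF e(2)])
    then obtain s where "0 < s" "s < 1" "edge_point a b s \<in> manifold_interior X"
      using edge_point_near[OF e, of 0] openin_manifold_interior by auto
    moreover have "carrier (edge_point a b s) = {a, b}"
      using e calculation by (auto simp: carrier_def edge_point_def)
    ultimately show ?thesis using interior_edge_point_two_faced[OF ab] by blast
  qed
  have "carrier x \<noteq> {}" using simplex_nonempty[OF carrier_simplex[OF xX]] .
  then consider "carrier x = {i}" | "carrier x = {j}" | "carrier x = {i, j}" using x(2) by blast
  then show ?thesis
  proof cases
    case 1
    then show ?thesis using vertex[OF j] by blast
  next
    case 2
    then show ?thesis using vertex[of i j] j neighbours_sym two_faced_sym by blast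
  next
    case 3
    then show ?thesis using interior_edge_point_two_faced[OF j x(1)] by blast
  qed
qed

lemma interior_edges_iff: "{i, j} \<in> interior_edges K \<longleftrightarrow> two_faced i j"
proof
  assume "{i, j} \<in> interior_edges K"
  then have e: "{i, j} \<in> K" "card {i, j} = 2" "\<not> closed_simplex K {i, j} \<subseteq> manifold_boundary X"
    unfolding interior_edges_def by auto
  then have "j \<in> neighbours K i" by (auto simp: neighbours_def card_insert_if split: if_splits)
  moreover obtain x where "x \<in> manifold_interior X" "carrier x \<subseteq> {i, j}"
    using e(3) unfolding closed_simplex_def manifold_boundary_def carrier_def by blast
  ultimately show "two_faced i j" using interior_point_two_faced by blast
next
  assume t: "two_faced i j"
  then have e: "{i, j} \<in> K" "i \<noteq> j" using two_faced_neighbour[OF t] by (auto simp: neighbours_def)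
  define m where "m = edge_point i j (1/2)"
  have m: "m \<in> X" "carrier m = {i, j}"
    using edge_point_in[OF e, of "1/2"] e by (auto simp: m_def carrier_def edge_point_def)
  then have "m \<in> manifold_interior X"
    by (intro two_faced_interior[OF t]) (auto simp: open_star_def mem_carrier[symmetric])
  then have "m \<in> closed_simplex K {i, j} - manifold_boundary X"
    using m by (auto simp: closed_simplex_def manifold_boundary_def carrier_def[symmetric])
  then show "{i, j} \<in> interior_edges K" using e by (auto simp: interior_edges_def)
qed

lemma interior_edgesE:
  assumes "e \<in> interior_edges K"
  obtains i j where "e = {i, j}" "two_faced i j"
proof -
  have "card e = 2" using assms by (simp add: interior_edges_def)
  then obtain i j where "e = {i, j}" by (auto simp: card_2_iff)
  then show ?thesis using that assms interior_edges_iff by blast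
qed

text \<open>If all edges at \<open>i\<close> have two faces, the punctured star consists of interior
  points, and a boundary point cannot be isolated in the boundary. This replaces a chart built from
  the cyclic order of the faces.\<close>

lemma interior_vertices_iff:
  "i \<in> interior_vertices K \<longleftrightarrow> {i} \<in> K \<and> (\<forall>j\<in>neighbours K i. two_faced i j)"
proof
  assume "i \<in> interior_vertices K"
  then have i: "{i} \<in> K" "\<not> closed_simplex K {i} \<subseteq> manifold_boundary X"
    by (auto simp: interior_vertices_def vertices_def)
  then obtain x where "x \<in> manifold_interior X" "carrier x \<subseteq> {i}"
    unfolding closed_simplex_def manifold_boundary_def carrier_def by blast
  then show "{i} \<in> K \<and> (\<forall>j\<in>neighbours K i. two_faced i j)"
    using i(1) interior_point_two_faced by blast
next
  assume i: "{i} \<in> K \<and> (\<forall>j\<in>neighbours K i. two_faced i j)"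
  then have v: "vertex_point i \<in> X" using vertex_point_in by blast
  have "open_star K i - {vertex_point i} \<subseteq> manifold_interior X"
  proof
    fix x
    assume x: "x \<in> open_star K i - {vertex_point i}"
    then have xX: "x \<in> X" and ix: "i \<in> carrier x" by (auto simp: open_star_def mem_carrier)
    then obtain j where j: "j \<in> carrier x" "j \<noteq> i" using vertex_point_unique[OF xX, of i] x by blast
    then have "{i, j} \<in> K" using face[OF carrier_simplex[OF xX], of "{i, j}"] ix by auto
    then have "two_faced i j" using i j by (auto simp: neighbours_def)
    then show "x \<in> manifold_interior X"
      by (rule two_faced_interior) (use xX ix j in \<open>auto simp: open_star_def mem_carrier\<close>)
  qed
  moreover have "vertex_point i \<in> open_star K i"
    using v by (simp add: open_star_def) (simp add: vertex_point_def)
  ultimately have "vertex_point i \<in> manifold_interior X"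
    using manifold_interior_isolated_point[OF manifold v open_star_open[of i]] by blast
  then have "vertex_point i \<in> closed_simplex K {i} - manifold_boundary X"
    using v by (auto simp: closed_simplex_def manifold_boundary_def carrier_def[symmetric] carrier_vertex_point)
  then show "i \<in> interior_vertices K" using i by (auto simp: interior_vertices_def vertices_def)
qed

text \<open>The stars of the vertices with value \<open>f i\<close> are disjoint from those of the
  others, since two vertices of one carrier are joined by an edge; \<open>X\<close> is
  connected.\<close>

lemma constant_on_vertices:
  assumes "\<And>i j. {i, j} \<in> K \<Longrightarrow> f i = f j" "{i} \<in> K" "{j} \<in> K"
  shows "f i = f j"
proof (rule ccontr)
  assume ne: "f i \<noteq> f j"
  define P where "P = (\<Union>v\<in>{v. f v = f i}. open_star K v)"
  define Q where "Q = (\<Union>v\<in>{v. f v \<noteq> f i}. open_star K v)"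
  have "openin (top_of_set X) P" "openin (top_of_set X) Q"
    unfolding P_def Q_def by (intro openin_Union; auto simp: open_star_open)+
  moreover have "X \<subseteq> P \<union> Q" using open_star_cover unfolding P_def Q_def by blast
  moreover have "P \<inter> Q = {}"
  proof (rule ccontr)
    assume "P \<inter> Q \<noteq> {}"
    then obtain x v w where "x \<in> X" "v \<in> carrier x" "w \<in> carrier x" "f v = f i" "f w \<noteq> f i"
      by (auto simp: P_def Q_def open_star_def mem_carrier)
    then show False using assms(1)[OF face[OF carrier_simplex[of x], of "{v, w}"]] by auto
  qed
  moreover have "vertex_point i \<in> P" "vertex_point j \<in> Q"
    using vertex_point_in assms ne unfolding P_def Q_def by (auto simp: open_star_def) (auto simp: vertex_point_def)
  ultimately show False using connected unfolding connected_openin by blast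
qed

end

section \<open>Integration of closed dual 1-forms\<close>

text \<open>By \<open>cyclic\<close> the orbit of any element is all of \<open>N\<close>.
  Accumulating \<open>l\<close> along it gives \<open>c\<close>, and the return to the start is
  consistent because the total vanishes.\<close>

lemma cyclic_permutation_potential:
  fixes l :: "'v \<Rightarrow> 'b::ab_group_add"
  assumes "finite N" "bij_betw s N N" "sum l N = 0"
    and cyclic: "\<And>S. S \<subseteq> N \<Longrightarrow> S \<noteq> {} \<Longrightarrow> s ` S \<subseteq> S \<Longrightarrow> S = N"
  obtains c where "\<And>j. j \<in> N \<Longrightarrow> c (s j) = c j + l j"
proof (cases "N = {}")
  case True
  then show ?thesis using that by blast
next
  case False
  then obtain j0 where j0: "j0 \<in> N" by blast
  have sN: "s j \<in> N" if "j \<in> N" for j using assms(2) that by (auto simp: bij_betw_def)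
  have inj: "inj_on s N" using assms(2) by (simp add: bij_betw_def)
  define p where "p k = (s ^^ k) j0" for k
  have pS: "p (Suc k) = s (p k)" for k by (simp add: p_def)
  have pN: "p k \<in> N" for k by (induction k) (use j0 sN in \<open>auto simp: p_def\<close>)
  have "\<not> inj p" using assms(1) pN by (meson finite_subset image_subsetI infinite_iff_countable_subset)
  then obtain a b where "a < b" "p a = p b" unfolding inj_def by (metis linorder_neqE_nat)
  then have ex: "\<exists>n. \<exists>m<n. p m = p n" by blast
  \<comment> \<open>The first repetition in the orbit; injectivity of \<open>s\<close> pushes it
    back to a return to \<open>p 0\<close>, so \<open>n\<close> is the cycle length.\<close>
  define n where "n = (LEAST n. \<exists>m<n. p m = p n)"
  obtain m where m: "m < n" "p m = p n" using LeastI_ex[OF ex] unfolding n_def by blast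
  have least: "p a \<noteq> p b" if "a < b" "b < n" for a b using not_less_Least that unfolding n_def by blast
  have "m = 0"
  proof (rule ccontr)
    assume "m \<noteq> 0"
    then obtain m' n' where mn: "m = Suc m'" "n = Suc n'" using m(1) by (metis not0_implies_Suc not_less0)
    then have "p m' = p n'" using m(2) inj pN by (simp add: pS inj_on_eq_iff)
    then show False using least[of m' n'] m(1) mn by simp
  qed
  then have n: "0 < n" "p n = p 0" using m by auto
  have pinj: "inj_on p {..<n}"
    by (rule inj_onI) (metis least lessThan_iff linorder_neqE_nat)
  have "p ` {..<n} = N"
  proof (rule cyclic)
    show "s ` p ` {..<n} \<subseteq> p ` {..<n}"
    proof safe
      fix k
      assume "k < n"
      then show "s (p k) \<in> p ` {..<n}"
        using n by (cases "Suc k = n") (auto simp: pS[symmetric])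
    qed
  qed (use pN n in auto)
  then have tot: "(\<Sum>k<n. l (p k)) = 0"
    using assms(3) pinj by (simp add: sum.reindex[OF pinj, symmetric, unfolded o_def] flip: \<open>p ` {..<n} = N\<close>)
  define c where "c j = (\<Sum>k<the_inv_into {..<n} p j. l (p k))" for j
  have cp: "c (p k) = (\<Sum>i<k. l (p i))" if "k < n" for k
    unfolding c_def using that by (simp add: the_inv_into_f_f[OF pinj])
  have "c (s j) = c j + l j" if "j \<in> N" for j
  proof -
    have "j \<in> p ` {..<n}" using that \<open>p ` {..<n} = N\<close> by simp
    then obtain k where k: "k < n" "j = p k" by blast
    show ?thesis
    proof (cases "Suc k = n")
      \<comment> \<open>The last element is mapped to \<open>p 0\<close>, where \<open>c\<close> is
        the empty sum.\<close>
      case True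
      have "s j = p 0" using k(2) n(2) True pS[of k] by simp
      then have "c (s j) = 0" using cp[OF n(1)] by simp
      moreover have "c j + l j = (\<Sum>k<Suc k. l (p k))" using k by (simp add: cp)
      ultimately show ?thesis using tot unfolding True by simp
    next
      case False
      then show ?thesis using k cp[of "Suc k"] by (simp add: cp pS)
    qed
  qed
  then show ?thesis using that by blast
qed

text \<open>If \<open>D \<noteq> N\<close>, the chain can be closed up to a cycle on which the sum vanishes.\<close>

lemma partial_permutation_potential:
  fixes l :: "'v \<Rightarrow> 'b::ab_group_add"
  assumes N: "finite N" "D \<subseteq> N" and s: "inj_on s D" "s ` D \<subseteq> N"
    and conn: "\<And>S. S \<subseteq> N \<Longrightarrow> S \<noteq> {} \<Longrightarrow> (\<And>j. j \<in> D \<Longrightarrow> j \<in> S \<longleftrightarrow> s j \<in> S) \<Longrightarrow> S = N"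
    and closed: "D = N \<Longrightarrow> sum l N = 0"
  obtains c where "\<And>j. j \<in> D \<Longrightarrow> c (s j) = c j + l j"
proof -
  have fin: "finite D" "finite (N - D)" "finite (N - s ` D)" using N finite_subset by auto
  have "card (N - D) = card (N - s ` D)"
    using N s fin by (simp add: card_Diff_subset card_image)
  \<comment> \<open>Elements without a successor are matched arbitrarily with elements that are not
    successors.\<close>
  then obtain b where b: "bij_betw b (N - D) (N - s ` D)" using fin finite_same_card_bij by blast
  define s' where "s' j = (if j \<in> D then s j else b j)" for j
  have "bij_betw s' D (s ` D)" using s(1) by (simp add: bij_betw_def s'_def inj_on_def)
  moreover have "bij_betw s' (N - D) (N - s ` D)"
    using b by (rule bij_betw_cong[THEN iffD1, rotated]) (simp add: s'_def)
  ultimately have "bij_betw s' (D \<union> (N - D)) (s ` D \<union> (N - s ` D))"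
    by (rule bij_betw_combine) auto
  moreover have "D \<union> (N - D) = N" "s ` D \<union> (N - s ` D) = N" using N s by auto
  ultimately have bij: "bij_betw s' N N" by simp
  have cyc: "S = N" if S: "S \<subseteq> N" "S \<noteq> {}" "s' ` S \<subseteq> S" for S
  proof (rule conn[OF S(1,2)])
    fix j
    assume j: "j \<in> D"
    have inj: "inj_on s' N" using bij by (simp add: bij_betw_def)
    \<comment> \<open>An injective self-map of a finite set is onto, so forward invariance of
      \<open>S\<close> already gives the equivalence that \<open>conn\<close> asks for.\<close>
    have "s' ` S = S"
    proof (rule card_subset_eq[OF _ S(3)])
      show "card (s' ` S) = card S" using inj S(1) by (intro card_image) (rule inj_on_subset)
    qed (use S(1) N(1) finite_subset in blast)
    then have "j \<in> S \<longleftrightarrow> s' j \<in> S" using inj_on_image_mem_iff[OF inj _ S(1), of j] j N(2) by blast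
    then show "j \<in> S \<longleftrightarrow> s j \<in> S" using j by (simp add: s'_def)
  qed
  obtain l' where l': "sum l' N = 0" "\<And>j. j \<in> D \<Longrightarrow> l' j = l j"
  proof (cases "D = N")
    case True
    then show ?thesis using that[of l] closed by blast
  next
    case False
    then obtain j1 where j1: "j1 \<in> N" "j1 \<notin> D" using N by blast
    \<comment> \<open>Only values on \<open>D\<close> are prescribed; the free value at
      \<open>j1\<close> makes the total zero.\<close>
    define l' where "l' j = (if j = j1 then - sum l D else if j \<in> D then l j else 0)" for j
    have "sum l' N = l' j1 + sum l' (N - {j1})" using N(1) j1(1) by (simp add: sum.remove)
    also have "sum l' (N - {j1}) = sum l D"
      using N j1 by (intro sum.mono_neutral_cong_right) (auto simp: l'_def)
    finally have "sum l' N = 0" by (simp add: l'_def)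
    moreover have "l' j = l j" if "j \<in> D" for j using that j1 by (auto simp: l'_def)
    ultimately show ?thesis using that by blast
  qed
  obtain c where "\<And>j. j \<in> N \<Longrightarrow> c (s' j) = c j + l' j"
    using cyclic_permutation_potential[OF N(1) bij l'(1) cyc] by blast
  then have "c (s j) = c j + l j" if "j \<in> D" for j using that N(2) l'(2) by (force simp: s'_def)
  then show ?thesis using that by blast
qed

context mesh
begin

lemma left_vertex_inj: "(i, j, k) \<in> T \<Longrightarrow> (i, j', k) \<in> T \<Longrightarrow> j = j'"
  using rotate left_unique by metis

text \<open>\<open>c j\<close> is the value on the face to the left of the edge from
  \<open>v\<close> to \<open>j\<close>; passing to the next face crosses the edge to
  \<open>k\<close>. If that edge has no left face, \<open>c k\<close> is a spare value. Closedness
  is demanded only where the faces go all the way round.\<close>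

lemma vertex_potential:
  fixes l :: "'v \<Rightarrow> 'b::ab_group_add"
  assumes v: "{v} \<in> K" and closed: "v \<in> interior_vertices K \<Longrightarrow> (\<Sum>j\<in>neighbours K v. l j) = 0"
  obtains c where "\<And>j k. (v, j, k) \<in> T \<Longrightarrow> c k = c j + l k"
proof -
  define N where "N = neighbours K v"
  define D where "D = {j. \<exists>k. (v, j, k) \<in> T}"
  define s where "s = left_vertex T v"
  have s: "(v, j, s j) \<in> T" if "j \<in> D" for j
    using that left_vertex unfolding D_def s_def by auto
  have N: "finite N" "D \<subseteq> N"
    using finite_neighbours[OF v] triangle_neighbours by (auto simp: N_def D_def)
  have sD: "s ` D \<subseteq> N" using triangle_neighbours(2)[OF s] by (auto simp: N_def)
  have inj: "inj_on s D" using s left_vertex_inj by (metis inj_onI)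
  \<comment> \<open>The jump belongs to the edge that is crossed, the one to the successor, hence
    the shifted summand below.\<close>
  obtain c where c: "\<And>j. j \<in> D \<Longrightarrow> c (s j) = c j + l (s j)"
  proof (rule partial_permutation_potential[OF N(1,2) inj sD, of "\<lambda>j. l (s j)"])
    fix S
    assume S: "S \<subseteq> N" "S \<noteq> {}" and st: "\<And>j. j \<in> D \<Longrightarrow> j \<in> S \<longleftrightarrow> s j \<in> S"
    show "S = N"
      unfolding N_def
    proof (rule link_connected[OF v S(1)[unfolded N_def] S(2)])
      fix j k
      assume jk: "{v, j, k} \<in> K" "distinct [v, j, k]" "j \<in> S"
      then have "(v, j, k) \<in> T \<or> (v, k, j) \<in> T" using oriented[of v j k] rotate by auto
      then show "k \<in> S"
      proof
        assume "(v, j, k) \<in> T"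
        then have "j \<in> D" "s j = k" using left_vertex by (auto simp: D_def s_def)
        then show ?thesis using st jk(3) by blast
      next
        assume "(v, k, j) \<in> T"
        then have "k \<in> D" "s k = j" using left_vertex by (auto simp: D_def s_def)
        then show ?thesis using st jk(3) by blast
      qed
    qed
  next
    \<comment> \<open>Now \<open>s\<close> permutes the neighbours, so each also has a predecessor
      and thereby a face on the right: \<open>v\<close> is interior.\<close>
    assume DN: "D = N"
    then have "card (s ` N) = card N" using inj card_image by blast
    then have onto: "s ` N = N" using sD DN N(1) card_subset_eq by blast
    have "two_faced v j" if "j \<in> N" for j
    proof -
      have "j \<in> s ` N" using onto that by simp
      then obtain i where i: "i \<in> N" "s i = j" by blast
      then have "(j, v, i) \<in> T" using s[of i] DN rotate by blast
      moreover have "(v, j, s j) \<in> T" using s DN that by simp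
      ultimately show ?thesis unfolding two_faced_def by blast
    qed
    then have "v \<in> interior_vertices K" using v by (simp add: interior_vertices_iff N_def)
    then have "sum l N = 0" using closed by (simp add: N_def)
    moreover have "sum l (s ` N) = (\<Sum>j\<in>N. l (s j))"
      using inj DN by (simp add: sum.reindex)
    ultimately show "(\<Sum>j\<in>N. l (s j)) = 0" using onto by simp
  qed blast
  have "c k = c j + l k" if "(v, j, k) \<in> T" for j k
  proof -
    have "j \<in> D" "s j = k" using that left_vertex by (auto simp: D_def s_def)
    then show ?thesis using c by blast
  qed
  then show ?thesis using that by blast
qed

text \<open>The integral of a closed dual 1-form \<open>l\<close>: its value on the face \<open>(i, j, k)\<close> is
  \<open>a i j = a j k = a k i\<close>. Potentials of \<open>l\<close> around the vertices exist by closedness; along an edge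
  two of them differ by a constant, and these constants form a closed primal 1-cochain.\<close>

lemma dual_form_exact:
  fixes l :: "'v \<Rightarrow> 'v \<Rightarrow> 'b::ab_group_add"
  assumes sc: "simply_connected X" and anti: "\<And>i j. l j i = - l i j"
    and closed: "\<And>i. i \<in> interior_vertices K \<Longrightarrow> (\<Sum>j\<in>neighbours K i. l i j) = 0"
  obtains a where "\<And>i j k. (i, j, k) \<in> T \<Longrightarrow> a i k = a i j + l i k"
    "\<And>i j k. (i, j, k) \<in> T \<Longrightarrow> a j k = a i j"
proof -
  have "\<exists>c. \<forall>j k. (v, j, k) \<in> T \<longrightarrow> c k = c j + l v k" for v
  proof (cases "{v} \<in> K")
    case True
    then show ?thesis using vertex_potential[OF True, of "l v"] closed by metis
  next
    case False
    then show ?thesis using triangle vertex_of_edge edge_of_triangle by blast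
  qed
  then obtain c where c: "\<And>v j k. (v, j, k) \<in> T \<Longrightarrow> c v k = c v j + l v k" by metis
  \<comment> \<open>The potential at \<open>w\<close> minus the one at \<open>v\<close>, both on the
    left face of the edge, or on the right face if there is no left one.\<close>
  define g where "g v w = (if \<exists>k. (v, w, k) \<in> T then c w (left_vertex T v w) - c v w
    else if \<exists>k. (w, v, k) \<in> T then c w v - c v (left_vertex T w v) else 0)" for v w
  have g1: "g i j = c j k - c i j" if "(i, j, k) \<in> T" for i j k
    using that left_vertex[OF that] by (auto simp: g_def)
  have g2: "g j i = c i j - c j k" if T: "(i, j, k) \<in> T" for i j k
  proof (cases "\<exists>m. (j, i, m) \<in> T")
    case True
    then obtain m where m: "(j, i, m) \<in> T" by blast
    \<comment> \<open>Crossing the edge changes both potentials by the same amount, so their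
      difference is the same on either face.\<close>
    have "c i m = c i j - l i j" using c[OF rotate[OF m]] by simp
    moreover have "c j i = c j k - l i j" using c[OF rotate[OF T]] anti[of i j] by simp
    ultimately show ?thesis using g1[OF m] by simp
  next
    case False
    then show ?thesis using T left_vertex[OF T] by (auto simp: g_def)
  qed
  have g0: "g u u = 0" for u using triangle_distinct by (auto simp: g_def)
  have "g u v + g v w = g u w" if K: "{u, v, w} \<in> K" for u v w
  proof (cases "distinct [u, v, w]")
    case True
    then consider "(u, v, w) \<in> T" | "(v, u, w) \<in> T" using oriented K by blast
    then show ?thesis
    proof cases
      case 1
      then show ?thesis using g1[OF 1] g1[OF rotate[OF 1]] g2[OF rotate[OF rotate[OF 1]]] by simp
    next
      case 2
      then show ?thesis using g2[OF 2] g1[OF rotate[OF 2]] g2[OF rotate[OF rotate[OF 2]]] by simp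
    qed
  next
    case False
    have "g u v + g v u = 0" if "u \<noteq> v" "u = w"
    proof -
      have "v \<in> neighbours K u" using K that by (auto simp: neighbours_def insert_commute)
      then obtain k where "(u, v, k) \<in> T \<or> (v, u, k) \<in> T" by (rule edge_has_triangle)
      then show ?thesis using g1 g2 by force
    qed
    then show ?thesis using False g0 by (cases "u = v"; cases "v = w") auto
  qed
  then obtain h where h: "\<And>v w. {v, w} \<in> K \<Longrightarrow> g v w = h w - h v"
    using simply_connected_cochain_exact[OF sc] by blast
  \<comment> \<open>Subtracting \<open>h i\<close> makes the potentials of the three vertices of a
    face agree on it.\<close>
  show ?thesis
  proof (rule that[of "\<lambda>i j. c i j - h i"])
    fix i j k
    assume T: "(i, j, k) \<in> T"
    show "c i k - h i = c i j - h i + l i k" using c[OF T] by simp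
    have "c j k - c i j = h j - h i" using g1[OF T] h[OF edge_of_triangle[OF T]] by simp
    then show "c j k - h j = c i j - h i" by (simp add: algebra_simps)
  qed
qed

end

section \<open>Gradients and cotangents\<close>

lemma signed_area_rotate: "signed_area z j k i = signed_area z i j k"
  by (simp add: signed_area_def algebra_simps)

lemma signed_area_nonzero:
  assumes "\<not> collinear {z i, z j, z k}"
  shows "signed_area z i j k \<noteq> 0"
proof
  assume 0: "signed_area z i j k = 0"
  define a b where "a = z j - z i" and "b = z k - z i"
  have "collinear {0, a, b}"
  proof (cases "a = 0")
    case False
    have "Im (cnj a * b) = 0" using 0 by (simp add: signed_area_def a_def b_def)
    then have "Im (b / a) = 0" by (simp add: complex_div_cnj[of b a] mult.commute)
    then have "b / a = of_real (Re (b / a))" by (simp add: complex_eq_iff)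
    then have "b = Re (b / a) *\<^sub>R a" using False by (metis nonzero_divide_eq_eq scaleR_conv_of_real)
    then show ?thesis unfolding collinear_lemma by blast
  qed (simp add: collinear_lemma)
  then have "collinear {z j, z i, z k}" by (simp add: collinear_3[of "z j"] a_def b_def)
  then show False using assms by (simp add: insert_commute)
qed

text \<open>Inner product and twice the area are the product of the side lengths times cosine and
  signed sine. \<open>arccos\<close> only sees the modulus of the sine, and oddness of
  \<open>cot\<close> restores the sign.\<close>

lemma cot_signed_angle:
  assumes "signed_area z i j k \<noteq> 0"
  shows "cot (signed_angle z i j k) = ((z i - z k) \<bullet> (z j - z k)) / (2 * signed_area z i j k)"
proof -
  define a b where "a = z i - z k" and "b = z j - z k"
  define D where "D = 2 * signed_area z i j k"
  define n where "n = norm a * norm b"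
  have D: "D = Im (cnj a * b)"
    unfolding D_def signed_area_rotate[of z i j k] by (simp add: a_def b_def signed_area_def)
  have "D \<noteq> 0" using assms by (simp add: D_def)
  then have "a \<noteq> 0" "b \<noteq> 0" using D by auto
  then have n: "0 < n" by (simp add: n_def)
  have dot: "a \<bullet> b = Re (cnj a * b)" by (simp add: inner_complex_def)
  have sq: "(a \<bullet> b)\<^sup>2 + D\<^sup>2 = n\<^sup>2"
    unfolding dot D n_def cmod_power2[symmetric] by (simp add: norm_mult)
  define c where "c = (a \<bullet> b) / n"
  have c1: "1 - c\<^sup>2 = (D / n)\<^sup>2" using n sq by (simp add: c_def power_divide field_simps)
  then have "c\<^sup>2 \<le> 1" by (metis diff_ge_0_iff_ge zero_le_power2)
  then have "\<bar>c\<bar> \<le> 1" by (simp add: abs_square_le_1)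
  then have "cot (arccos c) = c / sqrt (1 - c\<^sup>2)"
    by (simp add: cot_def cos_arccos_abs sin_arccos_abs)
  also have "\<dots> = (a \<bullet> b) / \<bar>D\<bar>"
    unfolding c1 using n by (simp add: c_def)
  finally have cot: "cot (arccos c) = (a \<bullet> b) / \<bar>D\<bar>" .
  have "signed_angle z i j k = sgn D * arccos c"
    by (simp add: signed_angle_def D_def sgn_mult c_def n_def a_def b_def)
  then have "cot (signed_angle z i j k) = (a \<bullet> b) / D"
    using \<open>D \<noteq> 0\<close> cot by (cases "0 < D") (auto simp: sgn_if)
  then show ?thesis by (simp add: a_def b_def D_def)
qed

lemma u_z_rotate: "u_z z u j k i = u_z z u i j k"
  by (simp add: u_z_def grad_def signed_area_rotate[of z j k i] algebra_simps)

lemma u_z_add: "u_z z (u + v) i j k = u_z z u i j k + u_z z v i j k"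
proof -
  have "grad z (u + v) i j k = grad z u i j k + grad z v i j k"
    unfolding grad_def add_divide_distrib[symmetric] by (simp add: algebra_simps)
  then show ?thesis by (simp add: u_z_def add_divide_distrib)
qed

lemma u_z_scale: "u_z z (fun_scale c u) i j k = c *\<^sub>R u_z z u i j k"
  by (simp add: u_z_def grad_def fun_scale_def scaleR_conv_of_real algebra_simps)

text \<open>Twice \<open>u_z\<close> is the slope \<open>p\<close> in the form
  \<open>Re (p * w) + b\<close>, the conjugate of the gradient.\<close>

lemma u_z_affine:
  assumes "signed_area z i j k \<noteq> 0"
    and "u i = Re (p * z i) + b" "u j = Re (p * z j) + b" "u k = Re (p * z k) + b"
  shows "u_z z u i j k = p / 2"
proof -
  have "\<i> * (of_real (u i) * (z k - z j) + of_real (u j) * (z i - z k) + of_real (u k) * (z j - z i))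
      = cnj p * of_real (2 * signed_area z i j k)"
    unfolding assms(2-4) signed_area_def by (simp add: complex_eq_iff algebra_simps)
  then have "grad z u i j k = cnj p" using assms(1) by (simp add: grad_def)
  then show ?thesis by (simp add: u_z_def)
qed

lemma u_z_diff:
  assumes "signed_area z i j k \<noteq> 0"
  shows "Re (2 * u_z z u i j k * (z j - z i)) = u j - u i"
proof -
  have "2 * u_z z u i j k * (z j - z i) =
      - \<i> * cnj (of_real (u i) * (z k - z j) + of_real (u j) * (z i - z k) + of_real (u k) * (z j - z i)) * (z j - z i)
        / of_real (2 * signed_area z i j k)"
    by (simp add: u_z_def grad_def)
  also have "Re \<dots> = Re (- \<i> * cnj (of_real (u i) * (z k - z j) + of_real (u j) * (z i - z k) + of_real (u k) * (z j - z i)) * (z j - z i))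
        / (2 * signed_area z i j k)"
    by (rule Re_divide_of_real)
  also have "Re (- \<i> * cnj (of_real (u i) * (z k - z j) + of_real (u j) * (z i - z k) + of_real (u k) * (z j - z i)) * (z j - z i))
      = (u j - u i) * (2 * signed_area z i j k)"
    by (simp add: signed_area_def algebra_simps)
  finally show ?thesis using assms by simp
qed

text \<open>Integrates \<open>u_z\<close> over the side opposite \<open>i\<close>: the real part is
  half the increment of \<open>u\<close>, the imaginary part is up to sign half the flux of the
  gradient through that side, expressed by the cotangents at \<open>k\<close> and
  \<open>j\<close>.\<close>

lemma u_z_cot:
  assumes "signed_area z i j k \<noteq> 0"
  shows "u_z z u i j k * (z j - z k) = of_real ((u j - u k) / 2) -
    \<i> / 2 * of_real (cot (signed_angle z i j k) * (u j - u i) + cot (signed_angle z k i j) * (u k - u i))"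
proof -
  define D where "D = 2 * signed_area z i j k"
  have D0: "D \<noteq> 0" using assms by (simp add: D_def)
  have D: "D = (Re (z j) - Re (z i)) * (Im (z k) - Im (z i)) - (Im (z j) - Im (z i)) * (Re (z k) - Re (z i))"
  proof -
    have half: "2 * (t / 2) = t" for t :: real by simp
    show ?thesis unfolding D_def signed_area_def half by (simp add: algebra_simps)
  qed
  have area: "signed_area z k i j = signed_area z i j k" 
    by (rule signed_area_rotate[symmetric])
  have c1: "cot (signed_angle z i j k) * D = (z i - z k) \<bullet> (z j - z k)"
    using cot_signed_angle[OF assms] D0 by (simp add: D_def)
  have c2: "cot (signed_angle z k i j) * D = (z k - z j) \<bullet> (z i - z j)"
    using cot_signed_angle[of z k i j] assms D0 by (simp add: D_def area)
  have "u_z z u i j k * of_real (2 * D) =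
      - \<i> * cnj (of_real (u i) * (z k - z j) + of_real (u j) * (z i - z k) + of_real (u k) * (z j - z i))"
    using D0 by (simp add: u_z_def grad_def D_def)
  then have "u_z z u i j k * (z j - z k) * of_real (2 * D) =
      - \<i> * cnj (of_real (u i) * (z k - z j) + of_real (u j) * (z i - z k) + of_real (u k) * (z j - z i)) * (z j - z k)"
    by (metis mult.assoc mult.commute)
  \<comment> \<open>With the area cleared this is a polynomial identity in the coordinates.\<close>
  also have "\<dots> = of_real ((u j - u k) * D) -
      \<i> * of_real (((z i - z k) \<bullet> (z j - z k)) * (u j - u i) + ((z k - z j) \<bullet> (z i - z j)) * (u k - u i))"
    unfolding D inner_complex_def by (simp add: complex_eq_iff algebra_simps)
  also have "\<dots> = (of_real ((u j - u k) / 2) -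
    \<i> / 2 * of_real (cot (signed_angle z i j k) * (u j - u i) + cot (signed_angle z k i j) * (u k - u i))) * of_real (2 * D)"
    unfolding c1[symmetric] c2[symmetric] by (simp add: field_simps)
  finally show ?thesis using D0 by simp
qed

text \<open>First isomorphism theorem: the classes are the fibres of \<open>\<phi>\<close>, so
  evaluating \<open>\<phi>\<close> at a representative chosen by \<open>SOME\<close> is well defined
  and injective on classes.\<close>

lemma isomorphic_to_quotientI:
  fixes \<phi> :: "('a \<Rightarrow> 'b::real_vector) \<Rightarrow> 'c \<Rightarrow> 'd::real_vector"
  assumes W: "fun_space.subspace W" and U: "fun_space.subspace U" and L: "fun_space.subspace L" "L \<subseteq> U"
    and surj: "\<phi> ` U = W"
    and add: "\<And>u v. u \<in> U \<Longrightarrow> v \<in> U \<Longrightarrow> \<phi> (u + v) = \<phi> u + \<phi> v"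
    and scale: "\<And>c u. u \<in> U \<Longrightarrow> \<phi> (fun_scale c u) = fun_scale c (\<phi> u)"
    and ker: "\<And>u. u \<in> U \<Longrightarrow> \<phi> u = 0 \<longleftrightarrow> u \<in> L"
  shows "isomorphic_to_quotient W U L"
proof -
  have eq: "\<phi> u = \<phi> v \<longleftrightarrow> u - v \<in> L" if "u \<in> U" "v \<in> U" for u v
  proof -
    have "u - v \<in> U" using fun_space.subspace_diff[OF U that] .
    moreover have "\<phi> u = \<phi> (u - v) + \<phi> v" using add[of "u - v" v] calculation that by simp
    ultimately show ?thesis using ker[of "u - v"] by auto
  qed
  define \<Phi> where "\<Phi> C = \<phi> (SOME u. u \<in> C)" for C
  have class_iff: "v \<in> coset_rel U L `` {u} \<longleftrightarrow> v \<in> U \<and> \<phi> v = \<phi> u" if "u \<in> U" for u v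
    using that eq[of u v] by (auto simp: coset_rel_def)
  have \<Phi>: "\<Phi> (coset_rel U L `` {u}) = \<phi> u" if "u \<in> U" for u
  proof -
    have "u \<in> coset_rel U L `` {u}" unfolding class_iff[OF that] using that by simp
    then have "(SOME v. v \<in> coset_rel U L `` {u}) \<in> coset_rel U L `` {u}" by (rule someI[of "\<lambda>v. v \<in> coset_rel U L `` {u}"])
    then show ?thesis unfolding \<Phi>_def class_iff[OF that] by blast
  qed
  have "bij_betw \<Phi> (U // coset_rel U L) W"
  proof (rule bij_betw_imageI)
    show "inj_on \<Phi> (U // coset_rel U L)"
    proof (rule inj_onI)
      fix A B
      assume "A \<in> U // coset_rel U L" "B \<in> U // coset_rel U L" and AB: "\<Phi> A = \<Phi> B"
      then obtain u v where uv: "u \<in> U" "A = coset_rel U L `` {u}" "v \<in> U" "B = coset_rel U L `` {v}"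
        by (metis quotientE)
      then have "\<phi> u = \<phi> v" using \<Phi> AB by simp
      then have "x \<in> A \<longleftrightarrow> x \<in> B" for x
        unfolding uv(2,4) class_iff[OF uv(1)] class_iff[OF uv(3)] by simp
      then show "A = B" by blast
    qed
    show "\<Phi> ` (U // coset_rel U L) = W"
    proof -
      have "U // coset_rel U L = (\<lambda>u. coset_rel U L `` {u}) ` U" by (auto simp: quotient_def)
      then have "\<Phi> ` (U // coset_rel U L) = (\<lambda>u. \<Phi> (coset_rel U L `` {u})) ` U"
        by (simp only: image_image)
      also have "\<dots> = \<phi> ` U" using \<Phi> by (rule image_cong[OF refl])
      finally show ?thesis using surj by simp
    qed
  qed
  moreover have "\<Phi> (coset_rel U L `` {u + v}) = \<Phi> (coset_rel U L `` {u}) + \<Phi> (coset_rel U L `` {v})"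
    if "u \<in> U" "v \<in> U" for u v
    using \<Phi> add that fun_space.subspace_add[OF U that] by simp
  moreover have "\<Phi> (coset_rel U L `` {fun_scale c u}) = fun_scale c (\<Phi> (coset_rel U L `` {u}))"
    if "u \<in> U" for c u
    using \<Phi> scale that fun_space.subspace_scale[OF U that] by simp
  ultimately show ?thesis using W U L unfolding isomorphic_to_quotient_def by blast
qed

section \<open>Quadratic differentials and harmonic functions\<close>

locale realized_mesh = mesh K T for K :: "'v set set" and T +
  fixes z :: "'v \<Rightarrow> complex"
  assumes realization: "realization T z"
begin

abbreviation W where "W \<equiv> holomorphic_quadratic_differentials K z"
abbreviation U where "U \<equiv> harmonic_functions K T z"
abbreviation L where "L \<equiv> linear_functions K z"

definition laplacian :: "('v \<Rightarrow> real) \<Rightarrow> 'v \<Rightarrow> real" where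
  "laplacian u i = (\<Sum>j\<in>neighbours K i.
     (cot (signed_angle z i j (left_vertex T i j)) + cot (signed_angle z j i (left_vertex T j i))) * (u j - u i))"

lemma harmonic_iff: "u \<in> U \<longleftrightarrow> (\<forall>i. {i} \<notin> K \<longrightarrow> u i = 0) \<and> (\<forall>i\<in>interior_vertices K. laplacian u i = 0)"
  by (simp add: harmonic_functions_def laplacian_def vertices_def)

lemma area:
  assumes "(i, j, k) \<in> T"
  shows "signed_area z i j k \<noteq> 0"
  by (rule signed_area_nonzero) (use assms realization in \<open>auto simp: realization_def\<close>)

lemma neighbour_distinct:
  assumes "j \<in> neighbours K i"
  shows "z j \<noteq> z i"
proof -
  obtain k where "(i, j, k) \<in> T \<or> (j, i, k) \<in> T" using edge_has_triangle[OF assms] by blast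
  then have "signed_area z i j k \<noteq> 0 \<or> signed_area z j i k \<noteq> 0" using area by blast
  then show ?thesis by (auto simp: signed_area_def)
qed

section \<open>The jumps of \<open>u_z\<close> around interior vertices\<close>

lemma du_z_eq:
  assumes "(i, j, k) \<in> T" "(j, i, m) \<in> T"
  shows "du_z T z u i j = u_z z u i j k - u_z z u j i m"
  using assms by (simp add: du_z_def left_vertex)

lemma du_z_sym: "du_z T z u j i = - du_z T z u i j"
  by (simp add: du_z_def)

text \<open>The piecewise linear interpolation is continuous: both faces give the increment
  \<open>u j - u i\<close> along their common edge.\<close>

lemma Re_du_z:
  assumes "two_faced i j"
  shows "Re (du_z T z u i j * (z j - z i)) = 0"
proof -
  obtain k m where T: "(i, j, k) \<in> T" "(j, i, m) \<in> T" using assms by (auto simp: two_faced_def)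
  have "Re (2 * u_z z u i j k * (z j - z i)) = u j - u i" "Re (2 * u_z z u j i m * (z i - z j)) = u i - u j"
    using u_z_diff[OF area[OF T(1)]] u_z_diff[OF area[OF T(2)]] by blast+
  then show ?thesis unfolding du_z_eq[OF T] by (simp add: algebra_simps)
qed

lemma interior_left:
  assumes "i \<in> interior_vertices K" "j \<in> neighbours K i"
  shows "(i, j, left_vertex T i j) \<in> T" "(j, i, left_vertex T j i) \<in> T"
proof -
  have "two_faced i j" using assms interior_vertices_iff by blast
  then show "(i, j, left_vertex T i j) \<in> T" "(j, i, left_vertex T j i) \<in> T"
    using left_vertex unfolding two_faced_def by auto
qed

text \<open>Around an interior vertex the right face of an edge is the left face of the preceding
  one, so sums over right faces turn into sums over left faces.\<close>

lemma sum_rotate: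
  fixes f :: "'v \<Rightarrow> 'v \<Rightarrow> 'a::comm_monoid_add"
  assumes i: "i \<in> interior_vertices K"
  shows "(\<Sum>j\<in>neighbours K i. f j (left_vertex T j i)) = (\<Sum>j\<in>neighbours K i. f (left_vertex T i j) j)"
proof (rule sum.reindex_bij_witness[where i = "left_vertex T i" and j = "\<lambda>j. left_vertex T j i"])
  fix j
  assume "j \<in> neighbours K i"
  then have T: "(i, j, left_vertex T i j) \<in> T" "(j, i, left_vertex T j i) \<in> T"
    using interior_left[OF i] by blast+
  show "left_vertex T i (left_vertex T j i) = j" using left_vertex[OF rotate[OF T(2)]] .
  show "left_vertex T (left_vertex T i j) i = j" using left_vertex[OF rotate[OF rotate[OF T(1)]]] .
  show "left_vertex T j i \<in> neighbours K i" using triangle_neighbours(1)[OF rotate[OF T(2)]] .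
  show "left_vertex T i j \<in> neighbours K i" using triangle_neighbours(2)[OF T(1)] .
  show "f (left_vertex T i (left_vertex T j i)) (left_vertex T j i) = f j (left_vertex T j i)"
    using left_vertex[OF rotate[OF T(2)]] by simp
qed

lemma sum_du_z:
  assumes "i \<in> interior_vertices K"
  shows "(\<Sum>j\<in>neighbours K i. du_z T z u i j) = 0"
proof -
  have "(\<Sum>j\<in>neighbours K i. u_z z u j i (left_vertex T j i)) =
      (\<Sum>j\<in>neighbours K i. u_z z u i j (left_vertex T i j))"
    unfolding sum_rotate[OF assms, of "\<lambda>j m. u_z z u j i m"] by (simp add: u_z_rotate[of z u i])
  then show ?thesis by (simp add: du_z_def sum_subtractf)
qed

text \<open>Summation by parts: each face at \<open>i\<close> contributes \<open>u_z\<close> times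
  its side opposite \<open>i\<close>. The real parts cancel around the vertex, and the imaginary
  parts assemble the cotangent Laplacian.\<close>

lemma sum_du_z_dz:
  assumes i: "i \<in> interior_vertices K"
  shows "(\<Sum>j\<in>neighbours K i. du_z T z u i j * (z j - z i)) = - \<i> / 2 * of_real (laplacian u i)"
proof -
  let ?N = "neighbours K i" and ?s = "left_vertex T i"
  have "(\<Sum>j\<in>?N. u_z z u j i (left_vertex T j i) * (z j - z i)) =
      (\<Sum>j\<in>?N. u_z z u i j (?s j) * (z (?s j) - z i))"
    unfolding sum_rotate[OF i, of "\<lambda>j m. u_z z u j i m * (z j - z i)"] by (simp add: u_z_rotate[of z u i])
  then have "(\<Sum>j\<in>?N. du_z T z u i j * (z j - z i)) =
      (\<Sum>j\<in>?N. u_z z u i j (?s j) * (z j - z i)) - (\<Sum>j\<in>?N. u_z z u i j (?s j) * (z (?s j) - z i))"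
    by (simp only: du_z_def left_diff_distrib sum_subtractf)
  also have "\<dots> = (\<Sum>j\<in>?N. u_z z u i j (?s j) * (z j - z (?s j)))"
    unfolding sum_subtractf[symmetric] by (intro sum.cong refl) (simp add: algebra_simps)
  also have "\<dots> = (\<Sum>j\<in>?N. of_real ((u j - u (?s j)) / 2) - \<i> / 2 * of_real
      (cot (signed_angle z i j (?s j)) * (u j - u i) + cot (signed_angle z (?s j) i j) * (u (?s j) - u i)))"
    by (intro sum.cong refl u_z_cot area interior_left(1)[OF i])
  also have "\<dots> = of_real ((\<Sum>j\<in>?N. u j - u (?s j)) / 2) - \<i> / 2 * of_real (\<Sum>j\<in>?N.
      cot (signed_angle z i j (?s j)) * (u j - u i) + cot (signed_angle z (?s j) i j) * (u (?s j) - u i))"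
    by (simp only: sum_subtractf of_real_sum[symmetric] sum_divide_distrib[symmetric] sum_distrib_left[symmetric])
  also have "(\<Sum>j\<in>?N. u j - u (?s j)) = 0"
    using sum_rotate[OF i, of "\<lambda>j m. u j"] by (simp add: sum_subtractf)
  also have "(\<Sum>j\<in>?N. cot (signed_angle z i j (?s j)) * (u j - u i) +
      cot (signed_angle z (?s j) i j) * (u (?s j) - u i)) = laplacian u i"
    using sum_rotate[OF i, of "\<lambda>j m. cot (signed_angle z j i m) * (u j - u i)"]
    by (simp add: laplacian_def distrib_right sum.distrib)
  finally show ?thesis by simp
qed

text \<open>Edges are unordered, so an orientation is chosen; the value is independent of it, as
  \<open>du_z T z u i j\<close> and \<open>z j - z i\<close> both change sign under
  reversal.\<close>

definition quad :: "('v \<Rightarrow> real) \<Rightarrow> 'v set \<Rightarrow> complex" where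
  "quad u e = (if e \<in> interior_edges K
     then case SOME (i, j). e = {i, j} of (i, j) \<Rightarrow> du_z T z u i j * (z j - z i) else 0)"

lemma quad_edge:
  assumes "two_faced i j"
  shows "quad u {i, j} = du_z T z u i j * (z j - z i)"
proof -
  obtain a b where ab: "(SOME (a, b). {i, j} = {a, b}) = (a, b)" by fastforce
  have "{i, j} = {a, b}"
    using someI[of "\<lambda>(a, b). {i, j} = {a, b}" "(i, j)"] ab by simp
  then have "a = i \<and> b = j \<or> a = j \<and> b = i" by (auto simp: doubleton_eq_iff)
  then have "du_z T z u a b * (z b - z a) = du_z T z u i j * (z j - z i)"
    using du_z_sym[of u i j] by (auto simp: algebra_simps)
  then show ?thesis using assms ab by (simp add: quad_def interior_edges_iff)
qed

lemma quad_outside: "e \<notin> interior_edges K \<Longrightarrow> quad u e = 0"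
  by (simp add: quad_def)

lemma fun_eq_on_edges:
  assumes "\<And>e. e \<notin> interior_edges K \<Longrightarrow> p e = q e" "\<And>i j. two_faced i j \<Longrightarrow> p {i, j} = q {i, j}"
  shows "p = q"
proof
  fix e
  show "p e = q e" using assms by (cases "e \<in> interior_edges K") (auto elim: interior_edgesE)
qed

lemma quad_add: "quad (u + v) = quad u + quad v"
  by (rule fun_eq_on_edges) (simp_all add: quad_edge quad_outside du_z_def u_z_add algebra_simps)

lemma quad_scale: "quad (fun_scale c u) = fun_scale c (quad u)"
proof -
  have "fun_scale c (quad u) e = of_real c * quad u e" for e
    by (simp add: fun_scale_def scaleR_conv_of_real)
  then show ?thesis
    by (intro fun_eq_on_edges)
      (simp_all add: quad_edge quad_outside du_z_def u_z_scale scaleR_conv_of_real algebra_simps)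
qed

lemma quad_in_W:
  assumes "u \<in> U"
  shows "quad u \<in> W"
  unfolding holomorphic_quadratic_differentials_def
proof (intro CollectI conjI ballI allI impI)
  show "Re (quad u e) = 0" if "e \<in> interior_edges K" for e
    using interior_edgesE[OF that] by (metis quad_edge Re_du_z)
  fix i
  assume i: "i \<in> interior_vertices K"
  then have q: "quad u {i, j} = du_z T z u i j * (z j - z i)" if "j \<in> neighbours K i" for j
    using quad_edge that interior_vertices_iff by blast
  have "laplacian u i = 0" using assms i by (simp add: harmonic_iff)
  then show "(\<Sum>j\<in>neighbours K i. quad u {i, j}) = 0"
    using sum_du_z_dz[OF i, of u] by (simp add: q)
  have "(\<Sum>j\<in>neighbours K i. quad u {i, j} / (z j - z i)) = (\<Sum>j\<in>neighbours K i. du_z T z u i j)"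
    by (intro sum.cong refl) (use q neighbour_distinct in force)
  then show "(\<Sum>j\<in>neighbours K i. quad u {i, j} / (z j - z i)) = 0" using sum_du_z[OF i] by simp
qed (simp add: quad_outside)

lemma vertex_has_triangle:
  assumes "{v} \<in> K"
  obtains j k where "(v, j, k) \<in> T"
proof -
  obtain j where "j \<in> neighbours K v" using vertex_has_neighbour[OF assms] by blast
  then obtain k where "(v, j, k) \<in> T \<or> (j, v, k) \<in> T" by (rule edge_has_triangle)
  then show ?thesis using that rotate by blast
qed

text \<open>Below, the affine function \<open>w \<mapsto> Re (p * w) + b\<close> is encoded as the pair \<open>(p, b)\<close>.\<close>

lemma quad_surj:
  assumes sc: "simply_connected X" and q: "q \<in> W"
  obtains u where "u \<in> U" "quad u = q"
proof -
  have q0: "q e = 0" if "e \<notin> interior_edges K" for e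
    using q that by (simp add: holomorphic_quadratic_differentials_def)
  then have Re_q: "Re (q e) = 0" for e
    using q by (cases "e \<in> interior_edges K") (auto simp: holomorphic_quadratic_differentials_def)
  \<comment> \<open>\<open>p i j\<close> is to be the jump of the slope, twice that of
    \<open>u_z\<close>; the constant term in \<open>l\<close> makes the affine function vanish at
    \<open>z i\<close>.\<close>
  define p where "p i j = 2 * q {i, j} / (z j - z i)" for i j
  define l where "l i j = (p i j, - Re (p i j * z i))" for i j
  define ev where "ev f w = Re (fst f * w) + snd f" for f :: "complex \<times> real" and w
  have p_sym: "p j i = - p i j" for i j
    unfolding p_def by (simp add: insert_commute[of j i] minus_divide_right)
  have "Re (p i j * (z j - z i)) = 0" for i j
    using Re_q[of "{i, j}"] by (cases "z j = z i") (simp_all add: p_def)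
  then have anti: "l j i = - l i j" for i j
    by (auto simp: l_def p_sym[of i j] algebra_simps)
  have closed: "(\<Sum>j\<in>neighbours K i. l i j) = 0" if "i \<in> interior_vertices K" for i
  proof -
    have "(\<Sum>j\<in>neighbours K i. p i j) = 2 * (\<Sum>j\<in>neighbours K i. q {i, j} / (z j - z i))"
      by (simp add: p_def sum_distrib_left)
    then have "(\<Sum>j\<in>neighbours K i. p i j) = 0"
      using q that by (simp add: holomorphic_quadratic_differentials_def)
    moreover have "(\<Sum>j\<in>neighbours K i. - Re (p i j * z i)) = - Re ((\<Sum>j\<in>neighbours K i. p i j) * z i)"
      by (simp only: sum_distrib_right Re_sum sum_negf)
    ultimately show ?thesis by (simp add: l_def prod_eq_iff fst_sum snd_sum)
  qed
  obtain a where a1: "\<And>i j k. (i, j, k) \<in> T \<Longrightarrow> a i k = a i j + l i k"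
      and a2: "\<And>i j k. (i, j, k) \<in> T \<Longrightarrow> a j k = a i j"
    using dual_form_exact[OF sc anti closed] by blast
  have ev_step: "ev (a i k) (z i) = ev (a i j) (z i)" if "(i, j, k) \<in> T" for i j k
    using a1[OF that] by (simp add: ev_def l_def algebra_simps)
  \<comment> \<open>\<open>l v k\<close> vanishes at \<open>z v\<close>, so the value there survives
    each crossing, and connectedness of the link carries it to every neighbour.\<close>
  have ev_const: "ev (a v j) (z v) = ev (a v j') (z v)"
    if v: "{v} \<in> K" and j: "j \<in> neighbours K v" "j' \<in> neighbours K v" for v j j'
  proof -
    let ?S = "{k \<in> neighbours K v. ev (a v k) (z v) = ev (a v j) (z v)}"
    have "?S = neighbours K v"
    proof (rule link_connected[OF v])
      fix i k
      assume ik: "{v, i, k} \<in> K" "distinct [v, i, k]" "i \<in> ?S"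
      then have T: "(v, i, k) \<in> T \<or> (v, k, i) \<in> T" using oriented[of v i k] rotate by auto
      then have "k \<in> neighbours K v" using triangle_neighbours by blast
      moreover have "ev (a v k) (z v) = ev (a v i) (z v)" using T ev_step by metis
      ultimately show "k \<in> ?S" using ik(3) by simp
    qed (use j in auto)
    then have "j' \<in> ?S" using j(2) by (rule equalityD2[THEN subsetD])
    then show ?thesis by simp
  qed
  \<comment> \<open>Any neighbour gives the same value, even one whose edge has no left
    face.\<close>
  define u where "u v = (if {v} \<in> K then ev (a v (SOME j. j \<in> neighbours K v)) (z v) else 0)" for v
  have u: "u v = ev (a v j) (z v)" if "j \<in> neighbours K v" for v j
  proof -
    have v: "{v} \<in> K" using that by (auto simp: neighbours_def intro: vertex_of_edge)
    have "(SOME j. j \<in> neighbours K v) \<in> neighbours K v" by (rule someI[of "\<lambda>j. j \<in> neighbours K v", OF that])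
    then show ?thesis using ev_const[OF v _ that] v by (simp add: u_def)
  qed
  have uz: "u_z z u i j k = fst (a i j) / 2" if T: "(i, j, k) \<in> T" for i j k
  proof -
    have "a j k = a i j" "a k i = a i j" using a2[OF T] a2[OF rotate[OF T]] by simp_all
    then have "u i = ev (a i j) (z i)" "u j = ev (a i j) (z j)" "u k = ev (a i j) (z k)"
      using u triangle_neighbours(1)[OF T] triangle_neighbours(1)[OF rotate[OF T]]
        triangle_neighbours(1)[OF rotate[OF rotate[OF T]]] by metis+
    then show ?thesis unfolding ev_def by (rule u_z_affine[OF area[OF T]])
  qed
  have quad: "quad u = q"
  proof (rule fun_eq_on_edges)
    fix i j
    assume t: "two_faced i j"
    then obtain k m where T: "(i, j, k) \<in> T" "(j, i, m) \<in> T" by (auto simp: two_faced_def)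
    \<comment> \<open>Seen from \<open>i\<close>, the right face is \<open>(i, m, j)\<close>, so
      turning around \<open>i\<close> crosses the edge to \<open>j\<close> from right to
      left.\<close>
    have "a i j = a j i + l i j"
      using a1[OF rotate[OF T(2)]] a2[OF T(2)] by simp
    then have du: "du_z T z u i j = p i j / 2"
      unfolding du_z_eq[OF T] uz[OF T(1)] uz[OF T(2)] by (simp add: l_def add_divide_distrib)
    have p: "p i j * (z j - z i) = 2 * q {i, j}"
      using neighbour_distinct[OF two_faced_neighbour[OF t]] by (simp add: p_def)
    have "quad u {i, j} = p i j * (z j - z i) / 2" by (simp only: quad_edge[OF t] du times_divide_eq_left)
    then show "quad u {i, j} = q {i, j}" unfolding p by simp
  qed (simp add: quad_outside q0)
  \<comment> \<open>Once \<open>quad u = q\<close> is known, harmonicity can be read off from the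
    vanishing sum of \<open>q\<close> around \<open>i\<close>.\<close>
  have "laplacian u i = 0" if i: "i \<in> interior_vertices K" for i
  proof -
    have "du_z T z u i j * (z j - z i) = q {i, j}" if "j \<in> neighbours K i" for j
      using quad_edge[of i j u] i that unfolding quad interior_vertices_iff by simp
    then have "- \<i> / 2 * of_real (laplacian u i) = (\<Sum>j\<in>neighbours K i. q {i, j})"
      unfolding sum_du_z_dz[OF i, symmetric] by simp
    also have "\<dots> = 0" using q i by (simp add: holomorphic_quadratic_differentials_def)
    finally show ?thesis by simp
  qed
  then have "u \<in> U" unfolding harmonic_iff by (simp add: u_def)
  then show ?thesis using that quad by blast
qed

lemma linear_du_z:
  assumes "u \<in> L" "two_faced i j"
  shows "du_z T z u i j = 0"
proof -
  obtain a b where u: "\<And>i. {i} \<in> K \<Longrightarrow> u i = Re (cnj a * z i) + b"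
    using assms(1) by (auto simp: linear_functions_def vertices_def)
  have uz: "u_z z u i j k = cnj a / 2" if T: "(i, j, k) \<in> T" for i j k
    using T rotate[OF T] rotate[OF rotate[OF T]]
    by (intro u_z_affine[OF area[OF T], of _ _ b] u) (blast intro: vertex_of_edge edge_of_triangle)+
  obtain k m where "(i, j, k) \<in> T" "(j, i, m) \<in> T" using assms(2) by (auto simp: two_faced_def)
  then show ?thesis by (simp add: du_z_eq uz)
qed

lemma linear_harmonic: "L \<subseteq> U"
proof
  fix u
  assume u: "u \<in> L"
  have "laplacian u i = 0" if i: "i \<in> interior_vertices K" for i
  proof -
    have "(\<Sum>j\<in>neighbours K i. du_z T z u i j * (z j - z i)) = 0"
      using linear_du_z[OF u] i interior_vertices_iff by (intro sum.neutral) simp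
    then show ?thesis unfolding sum_du_z_dz[OF i] by simp
  qed
  moreover have "u i = 0" if "{i} \<notin> K" for i using u that by (auto simp: linear_functions_def vertices_def)
  ultimately show "u \<in> U" by (simp add: harmonic_iff)
qed

text \<open>The gradient passes unchanged across edges with two faces, and connectedness of the link
  spreads it over all faces at \<open>v\<close>, also at the boundary.\<close>

lemma vertex_gradient_constant:
  assumes v: "{v} \<in> K" and du: "\<And>i j. two_faced i j \<Longrightarrow> du_z T z u i j = 0"
  obtains p where "\<And>j k. (v, j, k) \<in> T \<Longrightarrow> u_z z u v j k = p"
proof -
  obtain j0 k0 where T0: "(v, j0, k0) \<in> T" using vertex_has_triangle[OF v] .
  define p where "p = u_z z u v j0 k0"
  have cross: "u_z z u v i j = u_z z u v j k" if "(v, i, j) \<in> T" "(v, j, k) \<in> T" for i j k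
  proof -
    have T: "(v, j, k) \<in> T" "(j, v, i) \<in> T" using that rotate by blast+
    then have "du_z T z u v j = 0" using du by (auto simp: two_faced_def)
    then show ?thesis by (simp add: du_z_eq[OF T] u_z_rotate[of z u v i j])
  qed
  \<comment> \<open>Both faces at the edge to \<open>j\<close> are tested, vacuously if missing, so
    that the property spreads in either direction of rotation.\<close>
  let ?S = "{j \<in> neighbours K v. \<forall>k. ((v, j, k) \<in> T \<longrightarrow> u_z z u v j k = p) \<and> ((v, k, j) \<in> T \<longrightarrow> u_z z u v k j = p)}"
  have "?S = neighbours K v"
  proof (rule link_connected[OF v])
    have right: "k \<in> ?S" if jk: "(v, j, k) \<in> T" and p: "u_z z u v j k = p" for j k
    proof -
      have "u_z z u v k m = p" if "(v, k, m) \<in> T" for m using cross[OF jk that] p by simp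
      moreover have "u_z z u v m k = p" if "(v, m, k) \<in> T" for m
        using left_vertex_inj[OF jk that] p by simp
      ultimately show ?thesis using triangle_neighbours(2)[OF jk] by blast
    qed
    have left: "j \<in> ?S" if jk: "(v, j, k) \<in> T" and p: "u_z z u v j k = p" for j k
    proof -
      have "u_z z u v j m = p" if "(v, j, m) \<in> T" for m using left_unique[OF jk that] p by simp
      moreover have "u_z z u v m j = p" if "(v, m, j) \<in> T" for m using cross[OF that jk] p by simp
      ultimately show ?thesis using triangle_neighbours(1)[OF jk] by blast
    qed
    show "?S \<noteq> {}" using left[OF T0] unfolding p_def by blast
    fix j k
    assume jk: "{v, j, k} \<in> K" "distinct [v, j, k]" "j \<in> ?S"
    then consider "(v, j, k) \<in> T" | "(v, k, j) \<in> T" using oriented[of v j k] rotate by auto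
    then show "k \<in> ?S"
    proof cases
      case 1
      then show ?thesis using right jk(3) by blast
    next
      case 2
      then show ?thesis using left jk(3) by blast
    qed
  qed auto
  then have "u_z z u v j k = p" if "(v, j, k) \<in> T" for j k
    using that triangle_neighbours(1)[OF that] by blast
  then show ?thesis using that by blast
qed

text \<open>Constancy spreads from vertex to vertex, so the face gradients are collected in a
  function \<open>P\<close> of the vertices; the constant terms \<open>B\<close> of the affine
  pieces are then treated in the same way.\<close>

lemma quad_kernel:
  assumes u: "u \<in> U"
  shows "quad u = 0 \<longleftrightarrow> u \<in> L"
proof
  assume "u \<in> L"
  then show "quad u = 0"
    by (intro fun_eq_on_edges) (simp_all add: quad_edge quad_outside linear_du_z)
next
  assume q: "quad u = 0"
  have du: "du_z T z u i j = 0" if t: "two_faced i j" for i j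
  proof -
    have "du_z T z u i j * (z j - z i) = 0" using quad_edge[OF t, of u] q by simp
    then show ?thesis using neighbour_distinct[OF two_faced_neighbour[OF t]] by simp
  qed
  have "\<exists>p. \<forall>j k. (v, j, k) \<in> T \<longrightarrow> u_z z u v j k = p" if "{v} \<in> K" for v
    using vertex_gradient_constant[OF that du] by metis
  then obtain P where P: "\<And>v j k. {v} \<in> K \<Longrightarrow> (v, j, k) \<in> T \<Longrightarrow> u_z z u v j k = P v" by metis
  have P: "u_z z u v j k = P v" if "(v, j, k) \<in> T" for v j k
    using P[OF vertex_of_edge[OF edge_of_triangle[OF that]] that] .
  have PT: "P i = P j" if T: "(i, j, k) \<in> T" for i j k
    using P[OF T] P[OF rotate[OF T]] u_z_rotate[of z u j k i] by simp
  have PE: "P i = P j" if "{i, j} \<in> K" for i j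
  proof (cases "i = j")
    case False
    then have "j \<in> neighbours K i" using that by (auto simp: neighbours_def)
    then obtain k where "(i, j, k) \<in> T \<or> (j, i, k) \<in> T" by (rule edge_has_triangle)
    then show ?thesis using PT by metis
  qed simp
  define B where "B v = u v - Re (2 * P v * z v)" for v
  have BT: "B i = B j" if T: "(i, j, k) \<in> T" for i j k
    using u_z_diff[OF area[OF T], of u] PT[OF T] P[OF T] by (simp add: B_def algebra_simps)
  have BE: "B i = B j" if "{i, j} \<in> K" for i j
  proof (cases "i = j")
    case False
    then have "j \<in> neighbours K i" using that by (auto simp: neighbours_def)
    then obtain k where "(i, j, k) \<in> T \<or> (j, i, k) \<in> T" by (rule edge_has_triangle)
    then show ?thesis using BT by metis
  qed simp
  obtain p b where pb: "\<And>v. {v} \<in> K \<Longrightarrow> P v = p \<and> B v = b"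
    using constant_on_vertices[of P] constant_on_vertices[of B] PE BE by metis
  have "u v = Re (2 * p * z v) + b" if "{v} \<in> K" for v
    using pb[OF that] by (auto simp: B_def)
  then have "u = (\<lambda>v. if v \<in> vertices K then Re (cnj (cnj (2 * p)) * z v) + b else 0)"
    using u by (auto simp: harmonic_iff vertices_def)
  then show "u \<in> L" unfolding linear_functions_def by blast
qed

section \<open>Linear structure of the three function spaces\<close>

lemma subspace_W: "fun_space.subspace W"
  unfolding fun_space.subspace_def holomorphic_quadratic_differentials_def fun_scale_def
  by (auto simp: sum.distrib add_divide_distrib simp flip: scaleR_right.sum scaleR_left_distrib)
     (simp_all add: scaleR_conv_of_real sum_distrib_left[symmetric] times_divide_eq_right[symmetric] del: times_divide_eq_right)

lemma subspace_U: "fun_space.subspace U"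
proof -
  have "laplacian (u + v) i = laplacian u i + laplacian v i" for u v i
    by (simp add: laplacian_def sum.distrib[symmetric] algebra_simps)
  moreover have "laplacian (fun_scale c u) i = c * laplacian u i" for c u i
    unfolding laplacian_def sum_distrib_left fun_scale_def by (intro sum.cong refl) (simp add: algebra_simps)
  moreover have "laplacian 0 i = 0" for i by (simp add: laplacian_def)
  ultimately show ?thesis
    unfolding fun_space.subspace_def by (simp add: harmonic_iff fun_scale_def)
qed

lemma subspace_L: "fun_space.subspace L"
  unfolding fun_space.subspace_def
proof (intro conjI ballI allI)
  show "0 \<in> L" unfolding linear_functions_def
    by (intro CollectI exI[of _ 0]) (auto simp: fun_eq_iff)
  fix u assume "u \<in> L"
  then obtain a b where u: "u = (\<lambda>i. if i \<in> vertices K then Re (cnj a * z i) + b else 0)"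
    unfolding linear_functions_def by blast
  show "fun_scale c u \<in> L" for c unfolding linear_functions_def u
    by (intro CollectI exI[of _ "of_real c * a"] exI[of _ "c * b"]) (auto simp: fun_eq_iff fun_scale_def algebra_simps)
  fix v assume "v \<in> L"
  then obtain a' b' where v: "v = (\<lambda>i. if i \<in> vertices K then Re (cnj a' * z i) + b' else 0)"
    unfolding linear_functions_def by blast
  show "u + v \<in> L" unfolding linear_functions_def u v
    by (intro CollectI exI[of _ "a + a'"] exI[of _ "b + b'"]) (auto simp: fun_eq_iff algebra_simps)
qed

end

theorem theorem4p6:
  fixes K :: "'v set set" and T :: "('v \<times> 'v \<times> 'v) set" and z :: "'v \<Rightarrow> complex"
  assumes "triangular_mesh K T"
    and "simply_connected (underlying_space K)"
    and "realization T z"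
  shows "(\<forall>q \<in> holomorphic_quadratic_differentials K z.
            \<exists>u \<in> harmonic_functions K T z.
              \<forall>i j. {i, j} \<in> interior_edges K \<longrightarrow> q {i, j} = du_z T z u i j * (z j - z i)) \<and>
         fun_space.subspace (holomorphic_quadratic_differentials K z) \<and>
         isomorphic_to_quotient (holomorphic_quadratic_differentials K z)
           (harmonic_functions K T z) (linear_functions K z)"
proof -
  interpret realized_mesh K T z using assms by unfold_locales
  have "quad ` U = W" using quad_in_W quad_surj[OF assms(2)] by blast
  then have "isomorphic_to_quotient W U L"
    using subspace_W subspace_U subspace_L linear_harmonic quad_add quad_scale quad_kernel
    by (intro isomorphic_to_quotientI[of W U L quad])
  moreover have "\<exists>u\<in>U. \<forall>i j. {i, j} \<in> interior_edges K \<longrightarrow> q {i, j} = du_z T z u i j * (z j - z i)"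
    if "q \<in> W" for q
    using quad_surj[OF assms(2) that] quad_edge interior_edges_iff by metis
  ultimately show ?thesis using subspace_W by blast
qed

end
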